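(* Let $n\ge2$, $\tfrac12<s<1$, and let $F_s$ and $F_s^\theta$ be the fractional $2$-Hessian operators associated with $f=\sigma_2^{1/2}$ as defined in the context. Let $\Omega\subset\mathbb{R}^n$ be open, and let $u:\mathbb{R}^n\to\mathbb{R}$ be Lipschitz continuous with constant $L$, semi-concave with constant $SC$, and satisfy $$(1-s)F_s[u](x)\ge\eta_0>0,\qquad\forall x\in\Omega,$$ in the viscosity sense, for some constant $\eta_0>0$. Then there exists a positive constant $\theta$ depending only on $n$, $\eta_0$, $s$, $L$ and $SC$ such that $$F_s[u](x)=F_s^\theta[u](x),\qquad\forall x\in\Omega.$$
   Context: $\sigma_1(\lambda)=\sum_i\lambda_i$, $\sigma_2(\lambda)=\sum_{1\le i<j\le n}\lambda_i\lambda_j$ and $\Gamma_2=\{\lambda\in\mathbb{R}^n:\sigma_1(\lambda)>0,\ \sigma_2(\lambda)>0\}$. For a symmetric $n\times n$ matrix $A$ with eigenvalue vector $\lambda(A)\in\Gamma_2$, let $F(A)=\sigma_2^{1/2}(\lambda(A))$, $F^{ij}(A)=\partial F/\partial A_{ij}(A)$, and $$\mathcal{M}=\mathcal{M}_2=\{M=\{M^{ij}\}:\ \text{there is a symmetric } T \text{ with }\lambda(T)\in\Gamma_2\text{ and }M^{ij}=F^{ij}(T)\},$$ a set of positive definite symmetric matrices. With $\delta(u,x,y)=u(x+y)+u(x-y)-2u(x)$ and $\lambda_{\min}(M)$ the smallest eigenvalue of $M$, define $$F_s[u](x)=\inf_{M\in\mathcal{M}}\Big\{\frac12\int_{\mathbb{R}^n}\frac{\delta(u,x,y)}{|\sqrt{M}^{-1}y|^{n+2s}}\det\sqrt{M}^{-1}\,dy\Big\},$$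 $$F_s^\theta[u](x)=\inf_{M\in\mathcal{M}}\Big\{\frac12\int_{\mathbb{R}^n}\frac{\delta(u,x,y)}{|\sqrt{M}^{-1}y|^{n+2s}}\det\sqrt{M}^{-1}\,dy\ \Big|\ \lambda_{\min}(M)\ge\theta\Big\}.$$ Semi-concave with constant $SC\ge0$ (on $\mathbb{R}^n$): $u$ is continuous and $\delta(u,x,y)\le SC|y|^2$ for all $x,y\in\mathbb{R}^n$ (equivalently $u-\frac{SC}{2}|x|^2$ is concave). Viscosity sense: $F_s[u]\ge g$ in $\Omega$ in the viscosity sense means that whenever $x\in\Omega$, $N$ is an open neighborhood of $x$ in $\Omega$, $\psi\in C^2(\overline N)$, $\psi(x)=u(x)$ and $\psi(y)>u(y)$ for all $y\in N\setminus\{x\}$, the function $v$ equal to $\psi$ in $N$ and to $u$ in $\mathbb{R}^n\setminus N$ satisfies $F_s[v](x)\ge g(x)$. *)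

theory Defs
  imports "HOL-Analysis.Analysis"
begin

section \<open>Symmetric matrices and their eigenvalues\<close>

definition sym_matrices :: "(real^'n^'n) set" where
  "sym_matrices = {A. transpose A = A}"

definition diag_matrix :: "real^'n \<Rightarrow> real^'n^'n" where
  "diag_matrix l = (\<chi> i j. if i = j then l $ i else 0)"

text \<open>The vector of eigenvalues, repeated according to multiplicity, of a symmetric matrix. It is
  determined up to the order of its entries; an arbitrary order is chosen, and everything below
  is invariant under permutations of the entries.\<close>

definition eigvals :: "real^'n^'n \<Rightarrow> real^'n" where
  "eigvals A = (SOME l. \<exists>Q. orthogonal_matrix Q \<and> A = Q ** diag_matrix l ** transpose Q)"

definition min_eigenvalue :: "real^'n^'n \<Rightarrow> real" where
  "min_eigenvalue M = Min {c. \<exists>v. v \<noteq> 0 \<and> M *v v = c *\<^sub>R v}"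

definition pos_def :: "real^'n^'n \<Rightarrow> bool" where
  "pos_def M \<longleftrightarrow> M \<in> sym_matrices \<and> (\<forall>v. v \<noteq> 0 \<longrightarrow> v \<bullet> (M *v v) > 0)"

text \<open>Meaningful for positive definite matrices only, where the root exists and is unique.\<close>

definition matrix_sqrt :: "real^'n^'n \<Rightarrow> real^'n^'n" where
  "matrix_sqrt M = (THE R. pos_def R \<and> R ** R = M)"


section \<open>The 2-Hessian operator and its set of linearised coefficients\<close>

definition sigma1 :: "real^'n \<Rightarrow> real" where
  "sigma1 l = (\<Sum>i\<in>UNIV. l $ i)"

text \<open>The index type carries no order, so the pairs \<open>i < j\<close> are the two-element sets of indices.\<close>

definition sigma2 :: "real^'n \<Rightarrow> real" where
  "sigma2 l = (\<Sum>S | card S = 2. \<Prod>i\<in>S. l $ i)"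

definition Gamma2 :: "(real^'n) set" where
  "Gamma2 = {l. sigma1 l > 0 \<and> sigma2 l > 0}"

definition hess2 :: "real^'n^'n \<Rightarrow> real" where
  "hess2 A = sqrt (sigma2 (eigvals A))"

text \<open>\<open>hess2\<close> is a function on the symmetric matrices. As usual, the matrix of its partial
  derivatives \<open>F\<^sup>i\<^sup>j(T)\<close> is the symmetric matrix that represents its differential at \<open>T\<close> on the
  space of symmetric matrices, \<open>dF(T)[H] = (\<Sum>i j. F\<^sup>i\<^sup>j(T) H\<^sub>i\<^sub>j)\<close>; the inner product
  of two matrices in \<open>real^'n^'n\<close> is this double sum.\<close>

definition coeffs2 :: "(real^'n^'n) set" where
  "coeffs2 = {M. M \<in> sym_matrices \<and>
     (\<exists>T\<in>sym_matrices. eigvals T \<in> Gamma2 \<and>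
        (hess2 has_derivative (\<lambda>H. M \<bullet> H)) (at T within sym_matrices))}"


section \<open>The fractional operators\<close>

definition second_diff :: "('a::real_vector \<Rightarrow> real) \<Rightarrow> 'a \<Rightarrow> 'a \<Rightarrow> real" where
  "second_diff u x y = u (x + y) + u (x - y) - 2 * u x"

text \<open>Lebesgue integral with values in the extended reals. For a semi-concave Lipschitz function
  \<open>u\<close> the integrals below may equal \<open>-\<infinity>\<close> (when \<open>u\<close> has a concave kink at \<open>x\<close>), and for the test
  functions of the viscosity inequality they may equal \<open>\<infinity>\<close> (a test function may grow arbitrarily
  fast on an unbounded neighbourhood). The case \<open>\<infinity> - \<infinity>\<close> does not arise for these functions.\<close>

definition ext_integral :: "('a::euclidean_space \<Rightarrow> real) \<Rightarrow> ereal" where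
  "ext_integral f =
     enn2ereal (\<integral>\<^sup>+ y. ennreal (f y) \<partial>lborel) - enn2ereal (\<integral>\<^sup>+ y. ennreal (- f y) \<partial>lborel)"

definition frac_linear :: "real \<Rightarrow> real^'n^'n \<Rightarrow> (real^'n \<Rightarrow> real) \<Rightarrow> real^'n \<Rightarrow> ereal" where
  "frac_linear s M u x = ereal (1/2) * ext_integral (\<lambda>y.
     second_diff u x y / norm (matrix_inv (matrix_sqrt M) *v y) powr (real CARD('n) + 2 * s)
       * det (matrix_inv (matrix_sqrt M)))"

definition frac_hess2 :: "real \<Rightarrow> (real^'n \<Rightarrow> real) \<Rightarrow> real^'n \<Rightarrow> ereal" where
  "frac_hess2 s u x = (INF M\<in>coeffs2. frac_linear s M u x)"

definition frac_hess2_trunc :: "real \<Rightarrow> real \<Rightarrow> (real^'n \<Rightarrow> real) \<Rightarrow> real^'n \<Rightarrow> ereal" where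
  "frac_hess2_trunc s \<theta> u x =
     (INF M\<in>{M \<in> coeffs2. min_eigenvalue M \<ge> \<theta>}. frac_linear s M u x)"


section \<open>Semi-concavity and viscosity inequalities\<close>

definition semiconcave :: "real \<Rightarrow> ('a::real_normed_vector \<Rightarrow> real) \<Rightarrow> bool" where
  "semiconcave C u \<longleftrightarrow> 0 \<le> C \<and> continuous_on UNIV u \<and>
     (\<forall>x y. second_diff u x y \<le> C * (norm y)\<^sup>2)"

text \<open>\<open>C\<^sup>2\<close> on the closure of an open set \<open>N\<close>: twice differentiable in \<open>N\<close>, and the function, its
  gradient and its Hessian extend continuously to the closure.\<close>

definition C2_closure :: "(real^'n) set \<Rightarrow> (real^'n \<Rightarrow> real) \<Rightarrow> bool" where
  "C2_closure N \<psi> \<longleftrightarrow> (\<exists>(D :: real^'n \<Rightarrow> real^'n) (H :: real^'n \<Rightarrow> real^'n^'n).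
     continuous_on (closure N) \<psi> \<and> continuous_on (closure N) D \<and> continuous_on (closure N) H \<and>
     (\<forall>y\<in>N. (\<psi> has_derivative (\<lambda>h. D y \<bullet> h)) (at y) \<and> (D has_derivative (\<lambda>h. H y *v h)) (at y)))"

definition viscosity_ge ::
  "((real^'n \<Rightarrow> real) \<Rightarrow> real^'n \<Rightarrow> ereal) \<Rightarrow> (real^'n) set \<Rightarrow> (real^'n \<Rightarrow> real)
    \<Rightarrow> (real^'n \<Rightarrow> real) \<Rightarrow> bool" where
  "viscosity_ge G \<Omega> u g \<longleftrightarrow>
     (\<forall>x\<in>\<Omega>. \<forall>N \<psi>. open N \<and> x \<in> N \<and> N \<subseteq> \<Omega> \<and> C2_closure N \<psi> \<and>
        \<psi> x = u x \<and> (\<forall>y\<in>N - {x}. \<psi> y > u y)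
        \<longrightarrow> G (\<lambda>y. if y \<in> N then \<psi> y else u y) x \<ge> ereal (g x))"

end

theory Submission
  imports Defs
begin

text \<open>
  In terms of the trace and the Frobenius norm, the linearised coefficients are exactly the symmetric
  matrices \<open>M\<close> with \<open>tr M > 0\<close> and \<open>(tr M)\<^sup>2 / (n - 1) - |M|\<^sup>2 = 1/2\<close>, a sheet of a hyperboloid. Near
  its degenerate end a matrix has one small eigenvalue, while the others have a large sum and are
  nearly equal. With \<open>M = Q diag(m) Q\<^sup>T\<close>, the linear operator is, up to the factor 1/2, the integral
  \<open>J(m)\<close> of \<open>\<delta>(u, x, Q diag(\<surd>m) w) |w|\<^sup>-\<^sup>(\<^sup>n\<^sup>+\<^sup>2\<^sup>s\<^sup>)\<close>. Semi-concavity provides test functions at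
  every point, so the viscosity inequality gives \<open>J(m) \<ge> \<eta> > 0\<close> pointwise for all coefficient
  matrices.

  Let \<open>M\<close> have an eigenvalue below \<open>\<theta>\<close>. A suitable multiple \<open>c M\<close>, with \<open>c\<close> small, becomes a
  coefficient matrix \<open>M'\<close> after raising its small eigenvalue to some \<open>\<epsilon>\<close> that is still small.
  Averaging over the reflection in that eigendirection and using semi-concavity shows that raising
  the eigenvalue increases \<open>J\<close> by at most \<open>O(\<surd>\<epsilon>)\<close>. Hence \<open>J(c m) \<ge> \<eta> - O(\<surd>\<epsilon>) \<ge> \<eta>/2\<close>, and by
  homogeneity \<open>J(m) = c\<^sup>-\<^sup>s J(c m)\<close> is large; in particular it exceeds the value at the isotropic
  coefficient matrix, so \<open>M\<close> is irrelevant for the infimum.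
\<close>

section \<open>Diagonalisation of symmetric matrices\<close>

text \<open>As a simp rule it would turn \<open>transpose Q *v v\<close> into a row-vector product,
  and the cancellation rules for orthogonal matrices below would no longer match.\<close>

declare transpose_matrix_vector [simp del]

lemma diag_matrix_mult_vec: "diag_matrix d *v w = (\<chi> i. d $ i * w $ i)"
  by (simp add: diag_matrix_def matrix_vector_mult_def vec_eq_iff if_distrib [of "\<lambda>x. x * _"] cong: if_cong)

lemma diag_matrix_mult: "diag_matrix a ** diag_matrix b = diag_matrix (\<chi> i. a $ i * b $ i)"
  by (simp add: diag_matrix_def matrix_matrix_mult_def vec_eq_iff if_distrib [of "\<lambda>x. x * _"] cong: if_cong)

lemma transpose_diag_matrix [simp]: "transpose (diag_matrix l) = diag_matrix l"
  by (auto simp: diag_matrix_def transpose_def vec_eq_iff)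

lemma trace_diag_matrix: "trace (diag_matrix l) = (\<Sum>i\<in>UNIV. l $ i)"
  by (simp add: trace_def diag_matrix_def)

lemma det_diag_matrix: "det (diag_matrix l) = (\<Prod>i\<in>UNIV. l $ i)"
  by (subst det_diagonal) (auto simp: diag_matrix_def)

lemma inner_matrix_eq_trace: "(A :: real^'n^'n) \<bullet> B = trace (transpose A ** B)"
proof -
  have "A \<bullet> B = (\<Sum>i\<in>UNIV. \<Sum>j\<in>UNIV. A $ i $ j * B $ i $ j)"
    by (simp add: inner_vec_def)
  also have "\<dots> = (\<Sum>j\<in>UNIV. \<Sum>i\<in>UNIV. A $ i $ j * B $ i $ j)"
    by (rule sum.swap)
  also have "\<dots> = trace (transpose A ** B)"
    by (simp add: trace_def matrix_matrix_mult_def transpose_def)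
  finally show ?thesis .
qed

lemma trace_eq_inner: "trace (A :: real^'n^'n) = mat 1 \<bullet> A"
  by (simp add: inner_matrix_eq_trace transpose_mat)

lemma sym_matrices_inner_mult:
  assumes "(A :: real^'n^'n) \<in> sym_matrices"
  shows "(A *v v) \<bullet> w = v \<bullet> (A *v w)"
  using assms by (metis (mono_tags, lifting) sym_matrices_def dot_lmul_matrix mem_Collect_eq transpose_matrix_vector)

text \<open>For orthogonal \<open>Q\<close> this is the spectral form of a symmetric matrix:
  eigenvalues \<open>l\<close>, eigenvectors the columns of \<open>Q\<close>. Products, trace,
  Frobenius norm, determinant, root and inverse can then be read off from \<open>l\<close>.\<close>

definition conj_diag :: "real^'n^'n \<Rightarrow> real^'n \<Rightarrow> real^'n^'n" where
  "conj_diag Q l = Q ** diag_matrix l ** transpose Q"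

context
  fixes Q :: "real^'n^'n"
  assumes Q: "orthogonal_matrix Q"
begin

lemma orthogonal_matrix_cancel:
  "transpose Q ** Q = mat 1" "Q ** transpose Q = mat 1"
  "transpose Q *v (Q *v v) = v" "Q *v (transpose Q *v v) = v"
  "transpose Q ** (Q ** A) = A" "Q ** (transpose Q ** A) = A"
  using Q by (simp_all add: orthogonal_matrix_def matrix_vector_mul_assoc matrix_mul_assoc)

lemma inner_orthogonal_matrix: "(Q *v v) \<bullet> (Q *v w) = v \<bullet> w"
  using Q by (metis orthogonal_matrix_cancel(3) dot_lmul_matrix transpose_matrix_vector transpose_transpose)

lemma norm_orthogonal_matrix [simp]: "norm (Q *v v) = norm v"
  by (simp add: norm_eq_sqrt_inner inner_orthogonal_matrix)

lemma transpose_conj_diag: "transpose (conj_diag Q l) = conj_diag Q l"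
  by (simp add: conj_diag_def matrix_transpose_mul matrix_mul_assoc)

lemma conj_diag_sym: "conj_diag Q l \<in> sym_matrices"
  by (simp add: sym_matrices_def transpose_conj_diag)

lemma conj_diag_mult: "conj_diag Q a ** conj_diag Q b = conj_diag Q (\<chi> i. a $ i * b $ i)"
proof -
  have "conj_diag Q a ** conj_diag Q b
      = Q ** diag_matrix a ** (transpose Q ** Q) ** diag_matrix b ** transpose Q"
    by (simp add: conj_diag_def matrix_mul_assoc)
  also have "\<dots> = Q ** (diag_matrix a ** diag_matrix b) ** transpose Q"
    by (simp add: orthogonal_matrix_cancel matrix_mul_assoc)
  finally show ?thesis
    by (simp add: diag_matrix_mult conj_diag_def)
qed

lemma conj_diag_one: "conj_diag Q (\<chi> i. 1) = mat 1"
proof -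
  have "diag_matrix (\<chi> i. 1) = (mat 1 :: real^'n^'n)"
    by (simp add: diag_matrix_def mat_def vec_eq_iff)
  then show ?thesis
    by (simp add: conj_diag_def orthogonal_matrix_cancel)
qed

lemma conj_diag_mult_vec: "conj_diag Q l *v (Q *v w) = Q *v (\<chi> i. l $ i * w $ i)"
  by (simp add: conj_diag_def matrix_vector_mul_assoc [symmetric] orthogonal_matrix_cancel
      diag_matrix_mult_vec)

lemma trace_conj_diag: "trace (conj_diag Q l) = (\<Sum>i\<in>UNIV. l $ i)"
proof -
  have "trace (conj_diag Q l) = trace (transpose Q ** (Q ** diag_matrix l))"
    unfolding conj_diag_def by (rule trace_mul_sym)
  then show ?thesis
    by (simp add: orthogonal_matrix_cancel trace_diag_matrix)
qed

lemma inner_conj_diag: "conj_diag Q l \<bullet> conj_diag Q l = (\<Sum>i\<in>UNIV. (l $ i)\<^sup>2)"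
  by (simp add: inner_matrix_eq_trace transpose_conj_diag conj_diag_mult trace_conj_diag power2_eq_square)

lemma det_conj_diag: "det (conj_diag Q l) = (\<Prod>i\<in>UNIV. l $ i)"
proof -
  have "det Q * det Q = 1"
    using det_orthogonal_matrix [OF Q] by auto
  then show ?thesis
    by (simp add: conj_diag_def det_mul det_diag_matrix)
qed

text \<open>In the coordinates \<open>transpose Q *v v\<close> the matrix acts entrywise. Hence the
  set under \<open>Min\<close> in \<open>min_eigenvalue\<close> is finite and nonempty.\<close>

lemma conj_diag_eigen_iff:
  "(\<exists>v. v \<noteq> 0 \<and> conj_diag Q l *v v = c *\<^sub>R v) \<longleftrightarrow> c \<in> range (($) l)"
proof
  assume "\<exists>v. v \<noteq> 0 \<and> conj_diag Q l *v v = c *\<^sub>R v"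
  then obtain v where v: "v \<noteq> 0" "conj_diag Q l *v v = c *\<^sub>R v" by blast
  define w where "w = transpose Q *v v"
  have vw: "v = Q *v w" by (simp add: w_def orthogonal_matrix_cancel)
  with v have "w \<noteq> 0" by auto
  then obtain i where i: "w $ i \<noteq> 0" by (auto simp: vec_eq_iff)
  have "Q *v (\<chi> i. l $ i * w $ i) = Q *v (c *\<^sub>R w)"
    using v(2) by (simp add: vw conj_diag_mult_vec matrix_vector_mult_scaleR)
  then have "transpose Q *v (Q *v (\<chi> i. l $ i * w $ i)) = transpose Q *v (Q *v (c *\<^sub>R w))"
    by simp
  then have "(\<chi> i. l $ i * w $ i) = c *\<^sub>R w"
    by (simp only: orthogonal_matrix_cancel)
  then have "l $ i * w $ i = c * w $ i" by (simp add: vec_eq_iff)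
  with i show "c \<in> range (($) l)" by auto
next
  assume "c \<in> range (($) l)"
  then obtain i where i: "c = l $ i" by auto
  have "Q *v axis i 1 \<noteq> 0"
    by (metis norm_orthogonal_matrix norm_axis_1 norm_zero zero_neq_one)
  moreover have "(\<chi> j. l $ j * axis i 1 $ j) = c *\<^sub>R axis i (1::real)"
    by (auto simp: vec_eq_iff axis_def i)
  then have "conj_diag Q l *v (Q *v axis i 1) = c *\<^sub>R (Q *v axis i 1)"
    by (simp add: conj_diag_mult_vec matrix_vector_mult_scaleR)
  ultimately show "\<exists>v. v \<noteq> 0 \<and> conj_diag Q l *v v = c *\<^sub>R v" by blast
qed

lemma min_eigenvalue_conj_diag: "min_eigenvalue (conj_diag Q l) = Min (range (($) l))"
  unfolding min_eigenvalue_def by (simp add: conj_diag_eigen_iff)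

lemma pos_def_conj_diag:
  assumes "\<And>i. l $ i > 0"
  shows "pos_def (conj_diag Q l)"
  unfolding pos_def_def
proof (intro conjI allI impI conj_diag_sym)
  fix v :: "real^'n" assume "v \<noteq> 0"
  define w where "w = transpose Q *v v"
  have vw: "v = Q *v w" by (simp add: w_def orthogonal_matrix_cancel)
  with \<open>v \<noteq> 0\<close> have "w \<noteq> 0" by auto
  then obtain i where i: "w $ i \<noteq> 0" by (auto simp: vec_eq_iff)
  have "v \<bullet> (conj_diag Q l *v v) = (\<Sum>i\<in>UNIV. l $ i * (w $ i)\<^sup>2)"
    by (simp add: vw conj_diag_mult_vec inner_orthogonal_matrix)
       (simp add: inner_vec_def power2_eq_square mult_ac)
  also have "\<dots> > 0"
    by (rule sum_pos2 [of _ i]) (use assms i in \<open>auto simp: less_imp_le\<close>)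
  finally show "v \<bullet> (conj_diag Q l *v v) > 0" .
qed

end

text \<open>A maximal orthonormal set of eigenvectors is a basis: otherwise a maximiser of the quadratic
  form on the unit sphere of its orthogonal complement is a further eigenvector.\<close>

lemma spectral_theorem:
  fixes A :: "real^'n^'n"
  assumes A: "A \<in> sym_matrices"
  obtains Q l where "orthogonal_matrix Q" "A = conj_diag Q l"
proof -
  define good where "good = (\<lambda>B :: (real^'n) set. pairwise orthogonal B \<and> (\<forall>b\<in>B. norm b = 1) \<and>
    (\<forall>b\<in>B. \<exists>c. A *v b = c *\<^sub>R b))"
  have indep: "independent B \<and> finite B \<and> card B \<le> CARD('n)" if "good B" for B
  proof -
    have "independent B"
      using that by (intro pairwise_orthogonal_independent) (auto simp: good_def)
    then show ?thesis
      using independent_bound[of B] by simp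
  qed
  have "good {}" by (simp add: good_def pairwise_def)
  \<comment> \<open>Orthonormal sets are independent, so their cardinality is bounded by the
    dimension and one of largest size exists.\<close>
  then obtain B where B: "good B" and max: "\<And>B'. good B' \<Longrightarrow> card B' \<le> card B"
    using ex_has_greatest_nat[of good "{}" card "Suc CARD('n)"] indep by (auto simp: less_Suc_eq_le)
  define W where "W = {w. \<forall>b\<in>B. orthogonal b w}"
  have W0: "W = {0}"
  proof (rule ccontr)
    assume "W \<noteq> {0}"
    have subW: "subspace W"
      unfolding W_def by (rule subspace_orthogonal_to_vectors)
    then obtain w0 where w0: "w0 \<in> W" "w0 \<noteq> 0"
      using \<open>W \<noteq> {0}\<close> subspace_0[of W] by blast
    define S where "S = W \<inter> sphere 0 1"
    have "compact S"
      unfolding S_def by (intro closed_Int_compact closed_subspace subW compact_sphere)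
    moreover have "w0 /\<^sub>R norm w0 \<in> S"
      using w0 subW by (auto simp: S_def subspace_scale)
    moreover have "continuous_on S (\<lambda>v. v \<bullet> (A *v v))"
      by (intro continuous_intros matrix_vector_mult_linear_continuous_on)
    ultimately obtain v where v: "v \<in> S" and vmax: "\<And>w. w \<in> S \<Longrightarrow> w \<bullet> (A *v w) \<le> v \<bullet> (A *v v)"
      using continuous_attains_sup[of S "\<lambda>v. v \<bullet> (A *v v)"] by blast
    define c where "c = v \<bullet> (A *v v)"
    have vW: "v \<in> W" and nv: "norm v = 1" using v by (auto simp: S_def)
    have vv: "v \<bullet> v = 1" using nv by (simp add: norm_eq_1)
    have quad: "w \<bullet> (A *v w) \<le> c * (w \<bullet> w)" if "w \<in> W" for w
    proof (cases "w = 0")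
      case False
      have "w /\<^sub>R norm w \<in> S"
        using that False subW by (auto simp: S_def subspace_scale)
      from vmax[OF this] have "(w \<bullet> (A *v w)) / (norm w)\<^sup>2 \<le> c"
        by (simp add: c_def matrix_vector_mult_scaleR power2_eq_square field_simps)
      with False show ?thesis
        by (simp add: field_simps power2_norm_eq_inner)
    qed auto
    have AW: "A *v w \<in> W" if "w \<in> W" for w
    proof -
      have "orthogonal b (A *v w)" if "b \<in> B" for b
      proof -
        obtain k where "A *v b = k *\<^sub>R b" using B \<open>b \<in> B\<close> by (auto simp: good_def)
        then have "b \<bullet> (A *v w) = k * (b \<bullet> w)"
          by (metis sym_matrices_inner_mult[OF A] inner_scaleR_left)
        then show ?thesis
          using \<open>w \<in> W\<close> \<open>b \<in> B\<close> by (simp add: W_def orthogonal_def)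
      qed
      then show ?thesis by (simp add: W_def)
    qed
    define w where "w = A *v v - c *\<^sub>R v"
    have wW: "w \<in> W"
      unfolding w_def by (intro subspace_diff subspace_scale subW AW vW)
    have wv: "v \<bullet> w = 0"
      by (simp add: w_def inner_diff_right c_def vv)
    have wAv: "w \<bullet> (A *v v) = w \<bullet> w"
      using wv by (simp add: w_def inner_diff_right inner_diff_left inner_commute)
    \<comment> \<open>Maximality of \<open>v\<close> is tested at \<open>v + t *\<^sub>R w\<close>.
      The term of first order in \<open>t\<close> is bounded by one of second order, and a small
      positive \<open>t\<close> then forces \<open>w = 0\<close>. This replaces a Lagrange
      multiplier.\<close>
    have key: "2 * t * (w \<bullet> w) \<le> t\<^sup>2 * (c * (w \<bullet> w) - w \<bullet> (A *v w))" for t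
    proof -
      have "(v + t *\<^sub>R w) \<bullet> (A *v (v + t *\<^sub>R w)) \<le> c * ((v + t *\<^sub>R w) \<bullet> (v + t *\<^sub>R w))"
        by (intro quad subspace_add subspace_scale subW vW wW)
      moreover have "v \<bullet> (A *v w) = w \<bullet> w"
        using sym_matrices_inner_mult[OF A, of v w] wAv by (simp add: inner_commute)
      ultimately show ?thesis
        using wv wAv
        by (simp add: matrix_vector_right_distrib matrix_vector_mult_scaleR inner_add_left
            inner_add_right c_def [symmetric] vv inner_commute algebra_simps power2_eq_square)
    qed
    have "w \<bullet> w \<le> 0"
    proof (rule ccontr)
      assume "\<not> w \<bullet> w \<le> 0"
      then have pos: "w \<bullet> w > 0" by linarith
      define K where "K = \<bar>c * (w \<bullet> w) - w \<bullet> (A *v w)\<bar> + 1"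
      have K: "K > 0" by (simp add: K_def)
      define t where "t = (w \<bullet> w) / K"
      have t: "t > 0" using pos K by (simp add: t_def)
      have "2 * t * (w \<bullet> w) \<le> t\<^sup>2 * K"
        using key[of t] by (rule order_trans) (auto simp: K_def intro!: mult_left_mono)
      also have "\<dots> = t * (w \<bullet> w)" using K by (simp add: t_def power2_eq_square)
      finally show False using t pos by simp
    qed
    then have "w = 0" by (metis inner_ge_zero inner_eq_zero_iff order_antisym)
    then have eig: "A *v v = c *\<^sub>R v" by (simp add: w_def)
    have "v \<notin> B"
      using vW vv by (auto simp: W_def orthogonal_def)
    have "good (insert v B)"
      using B vW nv eig by (auto simp: good_def pairwise_insert W_def orthogonal_commute)
    from max[OF this] show False
      using \<open>v \<notin> B\<close> indep[OF B] by simp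
  qed
  have "span B = UNIV"
  proof (rule ccontr)
    assume "span B \<noteq> UNIV"
    then obtain x where "x \<noteq> 0" "\<And>y. y \<in> span B \<Longrightarrow> orthogonal x y"
      using orthogonal_to_subspace_exists_gen[of B UNIV] by (auto simp: span_UNIV psubset_eq)
    then have "x \<in> W" by (auto simp: W_def span_base orthogonal_commute)
    with W0 \<open>x \<noteq> 0\<close> show False by simp
  qed
  then have "card B = CARD('n)"
    using indep[OF B] dim_eq_card[of B UNIV] by (simp add: dim_UNIV)
  then obtain f where f: "bij_betw f (UNIV :: 'n set) B"
    using indep[OF B] by (metis finite_class.finite_UNIV finite_same_card_bij)
  have f1 [simp]: "norm (f i) = 1" for i
    using B bij_betwE[OF f] by (auto simp: good_def)
  have f2: "orthogonal (f i) (f j)" if "i \<noteq> j" for i j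
    using B f that by (auto simp: good_def pairwise_def bij_betw_def inj_on_def)
  have "\<forall>i. \<exists>c. A *v f i = c *\<^sub>R f i"
    using B bij_betwE[OF f] by (auto simp: good_def)
  then obtain c where c: "\<And>i. A *v f i = c i *\<^sub>R f i" by metis
  define Q where "Q = (\<chi> i j. f j $ i)"
  have Q: "orthogonal_matrix Q"
    by (simp add: orthogonal_matrix_orthonormal_columns column_def Q_def f2)
  have "A ** Q = Q ** diag_matrix (\<chi> i. c i)"
  proof -
    have "(A ** Q) $ i $ j = (Q ** diag_matrix (\<chi> i. c i)) $ i $ j" for i j
    proof -
      have "(A ** Q) $ i $ j = (A *v f j) $ i"
        by (simp add: matrix_matrix_mult_def matrix_vector_mult_def Q_def)
      also have "\<dots> = (Q ** diag_matrix (\<chi> i. c i)) $ i $ j"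
        by (simp add: c matrix_matrix_mult_def Q_def diag_matrix_def
            if_distrib [of "\<lambda>x. _ * x"] cong: if_cong)
      finally show ?thesis .
    qed
    then show ?thesis by (simp add: vec_eq_iff)
  qed
  then have "A ** Q ** transpose Q = conj_diag Q (\<chi> i. c i)"
    by (simp add: conj_diag_def)
  then have "A = conj_diag Q (\<chi> i. c i)"
    by (simp add: matrix_mul_assoc [symmetric] orthogonal_matrix_cancel[OF Q])
  with Q that show thesis by blast
qed

text \<open>If (R - S) v = \<mu> v, then 0 = |R v|^2 - |S v|^2 is the inner product of (R - S) v and
  (R + S) v, that is, \<mu> times the quadratic form of R + S at v. That form is positive, so every
  eigenvalue of R - S vanishes.\<close>

lemma pos_def_sqrt_unique:
  fixes R S :: "real^'n^'n"
  assumes R: "pos_def R" and S: "pos_def S" and eq: "R ** R = S ** S"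
  shows "R = S"
proof -
  have sym: "R \<in> sym_matrices" "S \<in> sym_matrices"
    using R S by (auto simp: pos_def_def)
  then have "R - S \<in> sym_matrices"
    by (auto simp: sym_matrices_def transpose_def vec_eq_iff)
  then obtain Q l where Q: "orthogonal_matrix Q" and l: "R - S = conj_diag Q l"
    by (rule spectral_theorem)
  have "l $ i = 0" for i
  proof -
    obtain v where v: "v \<noteq> 0" "(R - S) *v v = l $ i *\<^sub>R v"
      using conj_diag_eigen_iff[OF Q, of l "l $ i"] l by auto
    have "(R *v v) \<bullet> (R *v v) = v \<bullet> ((R ** R) *v v)"
      using sym by (simp add: sym_matrices_inner_mult matrix_vector_mul_assoc[symmetric])
    moreover have "(S *v v) \<bullet> (S *v v) = v \<bullet> ((S ** S) *v v)"
      using sym by (simp add: sym_matrices_inner_mult matrix_vector_mul_assoc[symmetric])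
    ultimately have "((R - S) *v v) \<bullet> (R *v v + S *v v) = 0"
      by (simp add: eq matrix_vector_mult_diff_rdistrib inner_add_right inner_diff_left inner_diff_right
          inner_commute)
    then have "l $ i * (v \<bullet> (R *v v) + v \<bullet> (S *v v)) = 0"
      by (simp add: v inner_add_right distrib_left del: mult_eq_0_iff)
    moreover have "v \<bullet> (R *v v) + v \<bullet> (S *v v) > 0"
      using R S v by (auto simp: pos_def_def intro!: add_pos_pos)
    ultimately show ?thesis by (metis less_irrefl mult_eq_0_iff)
  qed
  then have "l = 0" by (simp add: vec_eq_iff)
  then have "diag_matrix l = 0"
    by (simp add: diag_matrix_def vec_eq_iff)
  then have "R - S = 0"
    by (simp add: l conj_diag_def)
  then show ?thesis by simp
qed

lemma matrix_sqrt_conj_diag: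
  assumes Q: "orthogonal_matrix Q" and m: "\<And>i. m $ i > 0"
  shows "matrix_sqrt (conj_diag Q m) = conj_diag Q (\<chi> i. sqrt (m $ i))"
  unfolding matrix_sqrt_def
proof (rule the_equality)
  have "(\<chi> i. sqrt (m $ i) * sqrt (m $ i)) = m"
    using m by (simp add: vec_eq_iff less_imp_le)
  then show *: "pos_def (conj_diag Q (\<chi> i. sqrt (m $ i))) \<and>
      conj_diag Q (\<chi> i. sqrt (m $ i)) ** conj_diag Q (\<chi> i. sqrt (m $ i)) = conj_diag Q m"
    using m by (auto intro!: pos_def_conj_diag Q simp: conj_diag_mult[OF Q])
  fix R assume "pos_def R \<and> R ** R = conj_diag Q m"
  with * show "R = conj_diag Q (\<chi> i. sqrt (m $ i))"
    using pos_def_sqrt_unique by metis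
qed

lemma matrix_inv_conj_diag:
  assumes Q: "orthogonal_matrix Q" and m: "\<And>i. m $ i \<noteq> 0"
  shows "matrix_inv (conj_diag Q m) = conj_diag Q (\<chi> i. 1 / m $ i)"
proof -
  have right: "conj_diag Q m ** conj_diag Q (\<chi> i. 1 / m $ i) = mat 1"
    using m by (simp add: conj_diag_mult[OF Q] conj_diag_one[OF Q])
  moreover have "conj_diag Q (\<chi> i. 1 / m $ i) ** conj_diag Q m = mat 1"
    using m by (simp add: conj_diag_mult[OF Q] conj_diag_one[OF Q])
  ultimately have "matrix_inv (conj_diag Q m) ** conj_diag Q m = mat 1"
    using someI[of "\<lambda>B. conj_diag Q m ** B = mat 1 \<and> B ** conj_diag Q m = mat 1"]
    unfolding matrix_inv_def by blast
  with right show ?thesis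
    by (metis matrix_mul_assoc matrix_mul_lid matrix_mul_rid)
qed

section \<open>The dual hyperboloid of coefficient matrices\<close>

text \<open>The square of the sum runs over ordered pairs. The diagonal pairs give the sum of
  squares, and each two-element set arises from exactly two of the others. In this form
  \<open>sigma2\<close> of the eigenvalues depends only on trace and Frobenius norm.\<close>

lemma sigma2_eq: "sigma2 l = ((\<Sum>i\<in>UNIV. l $ i)\<^sup>2 - (\<Sum>i\<in>UNIV. (l $ i)\<^sup>2)) / 2"
  for l :: "real^'n"
proof -
  define P where "P = {p :: 'n \<times> 'n. fst p \<noteq> snd p}"
  define g where "g = (\<lambda>p :: 'n \<times> 'n. {fst p, snd p})"
  have "(\<Sum>i\<in>UNIV. l $ i)\<^sup>2 = (\<Sum>p\<in>UNIV. l $ fst p * l $ snd p)"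
    by (simp add: power2_eq_square sum_product sum.cartesian_product case_prod_unfold)
  also have "\<dots> = (\<Sum>p\<in>P. l $ fst p * l $ snd p) + (\<Sum>p\<in>-P. l $ fst p * l $ snd p)"
    by (subst sum.union_disjoint [symmetric]) (auto simp: Compl_partition)
  also have "(\<Sum>p\<in>-P. l $ fst p * l $ snd p) = (\<Sum>i\<in>UNIV. (l $ i)\<^sup>2)"
    by (rule sum.reindex_bij_witness[of _ "\<lambda>i. (i, i)" fst]) (auto simp: P_def power2_eq_square)
  also have "(\<Sum>p\<in>P. l $ fst p * l $ snd p) = (\<Sum>S | card S = 2. \<Sum>p\<in>{p\<in>P. g p = S}. l $ fst p * l $ snd p)"
    by (rule sum.group [symmetric]) (auto simp: P_def g_def)
  also have "\<dots> = (\<Sum>S | card S = 2. 2 * (\<Prod>i\<in>S. l $ i))"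
  proof (rule sum.cong)
    fix S :: "'n set" assume "S \<in> {S. card S = 2}"
    then obtain a b where ab: "S = {a, b}" "a \<noteq> b" by (auto simp: card_2_iff)
    have "{p\<in>P. g p = S} = {(a, b), (b, a)}"
      using ab by (auto simp: P_def g_def doubleton_eq_iff)
    then show "(\<Sum>p\<in>{p\<in>P. g p = S}. l $ fst p * l $ snd p) = 2 * (\<Prod>i\<in>S. l $ i)"
      using ab by simp
  qed simp
  also have "\<dots> = 2 * sigma2 l"
    by (simp add: sigma2_def sum_distrib_left)
  finally show ?thesis by simp
qed

text \<open>Whatever order the choice operator in \<open>eigvals\<close> picks, it comes from a
  diagonalisation; this is all that the trace formulas below need.\<close>

lemma eigvals_conj_diag:
  assumes "A \<in> sym_matrices"
  obtains Q where "orthogonal_matrix Q" "A = conj_diag Q (eigvals A)"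
proof -
  obtain Q l where "orthogonal_matrix Q" "A = conj_diag Q l"
    using assms by (rule spectral_theorem)
  then have "\<exists>l Q. orthogonal_matrix Q \<and> A = Q ** diag_matrix l ** transpose Q"
    by (auto simp: conj_diag_def)
  then have "\<exists>Q. orthogonal_matrix Q \<and> A = Q ** diag_matrix (eigvals A) ** transpose Q"
    unfolding eigvals_def by (rule someI_ex)
  then show thesis
    using that by (auto simp: conj_diag_def)
qed

lemma sigma1_eigvals: "A \<in> sym_matrices \<Longrightarrow> sigma1 (eigvals A) = trace A"
  by (metis eigvals_conj_diag trace_conj_diag sigma1_def)

lemma sigma2_eigvals: "A \<in> sym_matrices \<Longrightarrow> sigma2 (eigvals A) = ((trace A)\<^sup>2 - A \<bullet> A) / 2"
  by (metis eigvals_conj_diag trace_conj_diag inner_conj_diag sigma2_eq)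

lemma hess2_eq: "A \<in> sym_matrices \<Longrightarrow> hess2 A = sqrt (((trace A)\<^sup>2 - A \<bullet> A) / 2)"
  by (simp add: hess2_def sigma2_eigvals)

text \<open>On symmetric matrices \<open>hess2\<close> is the root of a quadratic form in the
  entries, which is differentiated directly. The two functions are only known to agree there, hence
  the derivative within \<open>sym_matrices\<close>.\<close>

lemma hess2_has_derivative:
  assumes T: "T \<in> sym_matrices" and pos: "(trace T)\<^sup>2 - T \<bullet> T > 0"
  shows "(hess2 has_derivative (\<lambda>H. ((1 / (2 * hess2 T)) *\<^sub>R (trace T *\<^sub>R mat 1 - T)) \<bullet> H))
    (at T within sym_matrices)"
proof (rule has_derivative_transform[OF T])
  let ?G = "\<lambda>A :: real^'n^'n. sqrt (((mat 1 \<bullet> A)\<^sup>2 - A \<bullet> A) / 2)"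
  show "hess2 A = ?G A" if "A \<in> sym_matrices" for A
    using that by (simp add: hess2_eq trace_eq_inner)
  define g where "g = ?G T"
  have gT: "g = hess2 T" using T by (simp add: hess2_eq trace_eq_inner g_def)
  have pos': "0 < ((mat 1 \<bullet> T)\<^sup>2 - T \<bullet> T) / 2"
    using pos by (simp add: trace_eq_inner)
  have "((\<lambda>A. ((mat 1 \<bullet> A)\<^sup>2 - A \<bullet> A) / 2) has_derivative
      (\<lambda>H. (mat 1 \<bullet> T) * (mat 1 \<bullet> H) - T \<bullet> H)) (at T within sym_matrices)"
    by (auto intro!: derivative_eq_intros ext simp: inner_commute field_simps)
  from has_derivative_real_sqrt[OF pos' this]
  show "(?G has_derivative (\<lambda>H. ((1 / (2 * hess2 T)) *\<^sub>R (trace T *\<^sub>R mat 1 - T)) \<bullet> H))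
    (at T within sym_matrices)"
  proof (rule has_derivative_eq_rhs, intro ext)
    fix H
    have "((1 / (2 * g)) *\<^sub>R (trace T *\<^sub>R mat 1 - T)) \<bullet> H =
        ((mat 1 \<bullet> T) * (mat 1 \<bullet> H) - T \<bullet> H) * (inverse g / 2)"
      by (simp only: inner_scaleR_left inner_diff_left trace_eq_inner) (simp add: inverse_eq_divide mult.commute)
    then show "((mat 1 \<bullet> T) * (mat 1 \<bullet> H) - T \<bullet> H) * (inverse (?G T) / 2) =
        ((1 / (2 * hess2 T)) *\<^sub>R (trace T *\<^sub>R mat 1 - T)) \<bullet> H"
      by (simp only: gT [symmetric] g_def [symmetric])
  qed
qed

text \<open>The line through \<open>T\<close> in direction \<open>M - N\<close> stays inside the
  symmetric matrices. Differentiating along it gives equal inner products of \<open>M\<close> and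
  \<open>N\<close> with \<open>M - N\<close>, so \<open>M - N\<close> has norm 0.\<close>

lemma sym_matrices_has_derivative_unique:
  fixes f :: "real^'n^'n \<Rightarrow> real"
  assumes M: "M \<in> sym_matrices" and N: "N \<in> sym_matrices" and T: "T \<in> sym_matrices"
    and dM: "(f has_derivative (\<lambda>H. M \<bullet> H)) (at T within sym_matrices)"
    and dN: "(f has_derivative (\<lambda>H. N \<bullet> H)) (at T within sym_matrices)"
  shows "M = N"
proof -
  define H where "H = M - N"
  have sym: "T + t *\<^sub>R H \<in> sym_matrices" for t
    using M N T by (auto simp: H_def sym_matrices_def transpose_def vec_eq_iff)
  have curve: "((\<lambda>t::real. T + t *\<^sub>R H) has_derivative (\<lambda>t. t *\<^sub>R H)) (at 0)"
    by (auto intro!: derivative_eq_intros)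
  have *: "((\<lambda>t. f (T + t *\<^sub>R H)) has_derivative (\<lambda>t. K \<bullet> (t *\<^sub>R H))) (at 0)"
    if "(f has_derivative (\<lambda>H. K \<bullet> H)) (at T within sym_matrices)" for K
  proof -
    have "(f has_derivative (\<lambda>H. K \<bullet> H)) (at (T + 0 *\<^sub>R H) within range (\<lambda>t. T + t *\<^sub>R H))"
      using that sym by (auto intro: has_derivative_subset)
    from diff_chain_within[OF curve this] show ?thesis by (simp add: o_def)
  qed
  have "(\<lambda>t::real. M \<bullet> (t *\<^sub>R H)) = (\<lambda>t. N \<bullet> (t *\<^sub>R H))"
    by (rule has_derivative_unique[OF *[OF dM] *[OF dN]])
  then have "M \<bullet> H = N \<bullet> H" by (metis scaleR_one)
  then have "H \<bullet> H = 0" by (simp add: H_def inner_diff_left)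
  then show ?thesis by (simp add: H_def)
qed

text \<open>Forwards, the gradient formula for \<open>hess2\<close> is inserted and \<open>T\<close>
  is eliminated. Backwards, the gradient map is inverted explicitly.\<close>

lemma coeffs2_iff:
  fixes M :: "real^'n^'n"
  assumes n: "CARD('n) \<ge> 2"
  shows "M \<in> coeffs2 \<longleftrightarrow>
    M \<in> sym_matrices \<and> trace M > 0 \<and> (trace M)\<^sup>2 / (real CARD('n) - 1) - M \<bullet> M = 1/2"
proof
  define n where "n = real CARD('n)"
  have n2: "n \<ge> 2" using n by (simp add: n_def)
  have tr1: "trace (mat 1 :: real^'n^'n) = n" "(mat 1 :: real^'n^'n) \<bullet> mat 1 = n"
    by (simp_all add: trace_I n_def trace_eq_inner[symmetric])
  have trs: "trace (a *\<^sub>R A) = a * trace A" for a and A :: "real^'n^'n"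
    by (simp add: trace_def sum_distrib_left)
  {
    assume "M \<in> coeffs2"
    then obtain T where M: "M \<in> sym_matrices" and T: "T \<in> sym_matrices" "eigvals T \<in> Gamma2"
      and d: "(hess2 has_derivative (\<lambda>H. M \<bullet> H)) (at T within sym_matrices)"
      by (auto simp: coeffs2_def)
    have t: "trace T > 0" and pos: "(trace T)\<^sup>2 - T \<bullet> T > 0"
      using T by (auto simp: Gamma2_def sigma1_eigvals sigma2_eigvals)
    define g where "g = hess2 T"
    have g: "g > 0" and g2: "T \<bullet> T = (trace T)\<^sup>2 - 2 * g\<^sup>2"
      using pos T by (simp_all add: g_def hess2_eq field_simps)
    define N where "N = (1 / (2 * g)) *\<^sub>R (trace T *\<^sub>R mat 1 - T)"
    have "N \<in> sym_matrices"
      using T by (auto simp: N_def sym_matrices_def transpose_def vec_eq_iff mat_def)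
    then have MN: "M = N"
      using sym_matrices_has_derivative_unique[OF M _ T(1) d] hess2_has_derivative[OF T(1) pos]
      by (simp add: N_def g_def)
    have trM: "trace M = (n - 1) * trace T / (2 * g)"
      by (simp add: MN N_def trs trace_sub tr1) (simp add: algebra_simps diff_divide_distrib)
    have "M \<bullet> M = (1 / (4 * g\<^sup>2)) * (n * (trace T)\<^sup>2 - 2 * (trace T)\<^sup>2 + T \<bullet> T)"
    proof -
      have "(trace T *\<^sub>R mat 1 - T) \<bullet> (trace T *\<^sub>R mat 1 - T) =
          n * (trace T)\<^sup>2 - 2 * (trace T)\<^sup>2 + T \<bullet> T"
        using trace_eq_inner[of T]
        by (simp add: inner_diff_left inner_diff_right tr1 inner_commute power2_eq_square algebra_simps)
      then show ?thesis by (simp add: MN N_def power2_eq_square)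
    qed
    then have MM: "M \<bullet> M = (1 / (4 * g\<^sup>2)) * ((n - 1) * (trace T)\<^sup>2 - 2 * g\<^sup>2)"
      by (simp add: g2 algebra_simps)
    have "(trace M)\<^sup>2 / (n - 1) = (1 / (4 * g\<^sup>2)) * ((n - 1) * (trace T)\<^sup>2)"
      using n2 g by (simp add: trM power2_eq_square field_simps)
    then have "(trace M)\<^sup>2 / (n - 1) - M \<bullet> M = 1/2"
      using g by (simp add: MM field_simps)
    moreover have "trace M > 0"
      using n2 g t by (simp add: trM)
    ultimately show "M \<in> sym_matrices \<and> trace M > 0 \<and>
        (trace M)\<^sup>2 / (real CARD('n) - 1) - M \<bullet> M = 1/2"
      using M by (simp add: n_def)
  next
    assume "M \<in> sym_matrices \<and> trace M > 0 \<and> (trace M)\<^sup>2 / (real CARD('n) - 1) - M \<bullet> M = 1/2"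
    then have M: "M \<in> sym_matrices" "trace M > 0" and MM': "(trace M)\<^sup>2 / (n - 1) - M \<bullet> M = 1/2"
      unfolding n_def by blast+
    from MM' have MM: "M \<bullet> M = (trace M)\<^sup>2 / (n - 1) - 1/2" by linarith
    \<comment> \<open>The gradient is homogeneous of degree 0, so \<open>T\<close> is sought with
      \<open>hess2 T = 1\<close>. Taking traces in M = (tr T I - T) / 2 gives tr T = 2 tr M / (n -
      1), and then T = tr T I - 2 M.\<close>
    define T where "T = (2 / (n - 1) * trace M) *\<^sub>R mat 1 - 2 *\<^sub>R M"
    have T: "T \<in> sym_matrices"
      using M by (auto simp: T_def sym_matrices_def transpose_def vec_eq_iff mat_def)
    have trT: "trace T = 2 / (n - 1) * trace M"
      using n2 by (simp add: T_def trs trace_sub tr1 field_simps)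
    have "T \<bullet> T = (2 / (n - 1) * trace M)\<^sup>2 * n - 8 / (n - 1) * (trace M)\<^sup>2 + 4 * (M \<bullet> M)"
      using trace_eq_inner[of M]
      by (simp add: T_def inner_diff_left inner_diff_right tr1 inner_commute power2_eq_square)
    also have "\<dots> = (trace T)\<^sup>2 - 2"
    proof -
      define a where "a = trace M / (n - 1)"
      have tM: "trace M = a * (n - 1)" using n2 by (simp add: a_def)
      have "8 / (n - 1) * (trace M)\<^sup>2 = 8 * a\<^sup>2 * (n - 1)" "M \<bullet> M = a\<^sup>2 * (n - 1) - 1/2"
        "2 / (n - 1) * trace M = 2 * a"
        using n2 unfolding MM tM by (simp_all add: power2_eq_square)
      then show ?thesis unfolding trT by (simp add: power2_eq_square algebra_simps)
    qed
    finally have TT: "(trace T)\<^sup>2 - T \<bullet> T = 2" by simp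
    have "hess2 T = 1" using T TT by (simp add: hess2_eq)
    moreover have "(1/2) *\<^sub>R (trace T *\<^sub>R mat 1 - T) = M"
      unfolding trT by (simp add: T_def vec_eq_iff algebra_simps)
    moreover have "(hess2 has_derivative
        (\<lambda>H. ((1 / (2 * hess2 T)) *\<^sub>R (trace T *\<^sub>R mat 1 - T)) \<bullet> H)) (at T within sym_matrices)"
      by (rule hess2_has_derivative[OF T]) (use TT in linarith)
    ultimately have "(hess2 has_derivative (\<lambda>H. M \<bullet> H)) (at T within sym_matrices)"
      by (simp only: mult_1_right)
    moreover have "eigvals T \<in> Gamma2"
    proof -
      have "trace T > 0" unfolding trT using M n2 by simp
      then show ?thesis
        unfolding Gamma2_def mem_Collect_eq sigma1_eigvals[OF T] sigma2_eigvals[OF T] TT by simp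
    qed
    ultimately show "M \<in> coeffs2"
      using M(1) T unfolding coeffs2_def by blast
  }
qed

lemma conj_diag_coeffs2_iff:
  fixes m :: "real^'n"
  assumes "CARD('n) \<ge> 2" and "orthogonal_matrix Q"
  shows "conj_diag Q m \<in> coeffs2 \<longleftrightarrow> (\<Sum>i\<in>UNIV. m $ i) > 0 \<and>
    (\<Sum>i\<in>UNIV. m $ i)\<^sup>2 / (real CARD('n) - 1) - (\<Sum>i\<in>UNIV. (m $ i)\<^sup>2) = 1/2"
  by (simp add: coeffs2_iff[OF assms(1)] conj_diag_sym trace_conj_diag[OF assms(2)]
      inner_conj_diag[OF assms(2)] conj_diag_sym[OF assms(2)])

text \<open>Cauchy-Schwarz for the other n - 1 entries, with sum \<tau>, turns the cone condition
  into (n - 2) m_k^2 < 2 m_k \<tau>. So m_k and \<tau> have the same sign, and their sum is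
  positive.\<close>

lemma dual_cone_positive:
  fixes m :: "real^'n"
  assumes n: "CARD('n) \<ge> 2" and pos: "(\<Sum>i\<in>UNIV. m $ i) > 0"
    and cone: "(\<Sum>i\<in>UNIV. m $ i)\<^sup>2 / (real CARD('n) - 1) > (\<Sum>i\<in>UNIV. (m $ i)\<^sup>2)"
  shows "m $ k > 0"
proof -
  define n where "n = real CARD('n)"
  have n2: "n \<ge> 2" using n by (simp add: n_def)
  define \<tau> where "\<tau> = (\<Sum>i\<in>UNIV - {k}. m $ i)"
  define q where "q = (\<Sum>i\<in>UNIV - {k}. (m $ i)\<^sup>2)"
  have s1: "(\<Sum>i\<in>UNIV. m $ i) = m $ k + \<tau>" and s2: "(\<Sum>i\<in>UNIV. (m $ i)\<^sup>2) = (m $ k)\<^sup>2 + q"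
    by (simp_all add: \<tau>_def q_def sum.remove[of UNIV k])
  have "\<tau>\<^sup>2 \<le> (n - 1) * q"
    using sum_squared_le_sum_of_squares[of "\<lambda>i. m $ i" "UNIV - {k}"]
    by (simp add: \<tau>_def q_def n_def card_Diff_singleton of_nat_diff mult.commute)
  moreover have "(n - 1) * ((m $ k)\<^sup>2 + q) < (m $ k + \<tau>)\<^sup>2"
    using cone n2 by (simp add: s1 s2 n_def [symmetric] field_simps)
  ultimately have "(n - 2) * (m $ k)\<^sup>2 < 2 * (m $ k * \<tau>)"
    by (simp add: power2_sum algebra_simps)
  moreover have "0 \<le> (n - 2) * (m $ k)\<^sup>2"
    using n2 by simp
  ultimately have "0 < m $ k * \<tau>" by linarith
  with pos s1 show ?thesis
    by (simp add: zero_less_mult_iff) linarith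
qed

lemma coeffs2_conj_diagE:
  fixes M :: "real^'n^'n"
  assumes n: "CARD('n) \<ge> 2" and M: "M \<in> coeffs2"
  obtains Q m where "orthogonal_matrix Q" "M = conj_diag Q m" "\<And>i. m $ i > 0"
proof -
  have "M \<in> sym_matrices" using M by (simp add: coeffs2_def)
  then obtain Q m where Q: "orthogonal_matrix Q" and m: "M = conj_diag Q m"
    by (rule spectral_theorem)
  from M have *: "(\<Sum>i\<in>UNIV. m $ i) > 0 \<and>
    (\<Sum>i\<in>UNIV. m $ i)\<^sup>2 / (real CARD('n) - 1) - (\<Sum>i\<in>UNIV. (m $ i)\<^sup>2) = 1/2"
    by (simp add: m conj_diag_coeffs2_iff[OF n Q])
  have "m $ i > 0" for i
    by (rule dual_cone_positive[OF n]) (use * in linarith)+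
  with Q m show thesis by (rule that)
qed

section \<open>Change of variables\<close>

lemma nn_integral_lborel_translate:
  fixes f :: "'a::euclidean_space \<Rightarrow> ennreal"
  assumes [measurable]: "f \<in> borel_measurable borel"
  shows "(\<integral>\<^sup>+x. f (a + x) \<partial>lborel) = (\<integral>\<^sup>+x. f x \<partial>lborel)"
proof -
  have "(\<integral>\<^sup>+x. f x \<partial>lborel) = (\<integral>\<^sup>+x. f x \<partial>density (distr lborel borel (\<lambda>x. a + 1 *\<^sub>R x)) (\<lambda>_. ennreal (\<bar>1::real\<bar>^DIM('a))))"
    by (subst lborel_affine[of 1 a, symmetric]) auto
  also have "\<dots> = (\<integral>\<^sup>+x. f (a + x) \<partial>lborel)"
    by (simp add: nn_integral_density nn_integral_distr)
  finally show ?thesis by simp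
qed

lemma nn_integral_lborel_reflect:
  fixes f :: "'a::euclidean_space \<Rightarrow> ennreal"
  assumes [measurable]: "f \<in> borel_measurable borel"
  shows "(\<integral>\<^sup>+x. f (a - x) \<partial>lborel) = (\<integral>\<^sup>+x. f x \<partial>lborel)"
proof -
  have "(\<integral>\<^sup>+x. f x \<partial>lborel) = (\<integral>\<^sup>+x. f x \<partial>density (distr lborel borel (\<lambda>x. a + (-1) *\<^sub>R x)) (\<lambda>_. ennreal (\<bar>-1::real\<bar>^DIM('a))))"
    by (subst lborel_affine[of "-1" a, symmetric]) auto
  also have "\<dots> = (\<integral>\<^sup>+x. f (a - x) \<partial>lborel)"
    by (simp add: nn_integral_density nn_integral_distr)
  finally show ?thesis by simp
qed

text \<open>Uniqueness of Haar measure: evaluate \<open>\<integral>\<integral> 1\<^sub>A(x - y) 1\<^sub>B(x) dN(x) dy\<close> in both orders, with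
  \<open>N\<close> the image of Lebesgue measure under the isometry and \<open>B\<close> the unit ball, on which the two
  measures agree.\<close>

lemma distr_lborel_isometry:
  fixes f :: "'a::euclidean_space \<Rightarrow> 'a"
  assumes f: "orthogonal_transformation f"
  shows "distr lborel borel f = lborel"
proof -
  define N where "N = distr lborel borel f"
  have lin: "linear f" and nf: "\<And>v. norm (f v) = norm v"
    using f orthogonal_transformation_norm by (auto simp: orthogonal_transformation_def)
  have [measurable]: "f \<in> borel_measurable borel"
    by (intro borel_measurable_continuous_onI linear_continuous_on linear_conv_bounded_linear[THEN iffD1] lin)
  have sN [measurable_cong]: "sets N = sets borel" by (simp add: N_def)
  \<comment> \<open>\<open>N\<close> is translation invariant: since \<open>f\<close> is linear and
    onto, a shift by \<open>a = f b\<close> pulls back to a shift by \<open>b\<close>.\<close>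
  have trans: "(\<integral>\<^sup>+x. g (x - a) \<partial>N) = (\<integral>\<^sup>+x. g x \<partial>N)"
    if [measurable]: "g \<in> borel_measurable borel" for g :: "'a \<Rightarrow> ennreal" and a
  proof -
    obtain b where b: "f b = a"
      using orthogonal_transformation_surj[OF f] by (metis surjD)
    have "(\<integral>\<^sup>+x. g (x - a) \<partial>N) = (\<integral>\<^sup>+x. g (f (- b + x)) \<partial>lborel)"
      by (simp add: N_def nn_integral_distr b[symmetric] linear_diff[OF lin, symmetric])
    also have "\<dots> = (\<integral>\<^sup>+x. g (f x) \<partial>lborel)"
      by (rule nn_integral_lborel_translate) simp
    finally show ?thesis by (simp add: N_def nn_integral_distr)
  qed
  have bal: "f -` ball 0 1 = ball 0 1" by (auto simp: nf)
  have NB: "emeasure N (ball 0 1) = emeasure lborel (ball 0 1 :: 'a set)"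
    by (simp add: N_def emeasure_distr bal)
  have fin: "emeasure lborel (ball 0 1 :: 'a set) < \<infinity>" by (rule emeasure_lborel_ball_finite)
  have pos: "emeasure lborel (ball 0 1 :: 'a set) > 0"
    by (simp add: emeasure_ball unit_ball_vol_pos ennreal_zero_less_mult_iff)
  \<comment> \<open>Fubini needs this. The isometry preserves centred balls, so they have finite
    \<open>N\<close>-measure and exhaust the space.\<close>
  interpret N: sigma_finite_measure N
  proof
    define A where "A = range (\<lambda>n::nat. ball (0::'a) (real n))"
    have "countable A" "A \<subseteq> sets N" "\<Union>A = space N"
      by (auto simp: A_def N_def) (meson reals_Archimedean2)
    moreover have "emeasure N (ball 0 (real n)) \<noteq> \<infinity>" for n
    proof -
      have "f -` ball 0 (real n) = ball 0 (real n)" by (auto simp: nf)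
      then have "emeasure N (ball 0 (real n)) = emeasure lborel (ball (0::'a) (real n))"
        by (simp add: N_def emeasure_distr)
      then show ?thesis using emeasure_lborel_ball_finite[of "0::'a" "real n"] by auto
    qed
    ultimately show "\<exists>A. countable A \<and> A \<subseteq> sets N \<and> \<Union>A = space N \<and> (\<forall>a\<in>A. emeasure N a \<noteq> \<infinity>)"
      by (intro exI[of _ A]) (auto simp: A_def)
  qed
  interpret P: pair_sigma_finite N lborel ..
  have "emeasure N A = emeasure lborel A" if [measurable]: "A \<in> sets borel" for A
  proof -
    define B where "B = (ball 0 1 :: 'a set)"
    have [measurable]: "B \<in> sets borel" by (simp add: B_def)
    have "(\<integral>\<^sup>+y. \<integral>\<^sup>+x. indicator A (x - y) * indicator B x \<partial>N \<partial>lborel) =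
        (\<integral>\<^sup>+x. \<integral>\<^sup>+y. indicator A (x - y) * indicator B x \<partial>lborel \<partial>N)"
      by (rule P.Fubini') measurable
    also have "\<dots> = (\<integral>\<^sup>+x. (\<integral>\<^sup>+y. indicator A (x - y) \<partial>lborel) * indicator B x \<partial>N)"
      by (simp add: nn_integral_multc)
    also have "\<dots> = (\<integral>\<^sup>+x. emeasure lborel A * indicator B x \<partial>N)"
      by (simp add: nn_integral_lborel_reflect)
    also have "\<dots> = emeasure lborel A * emeasure N B"
      by (simp add: nn_integral_cmult)
    finally have 1: "(\<integral>\<^sup>+y. \<integral>\<^sup>+x. indicator A (x - y) * indicator B x \<partial>N \<partial>lborel) =
        emeasure lborel A * emeasure N B" .
    have "(\<integral>\<^sup>+y. \<integral>\<^sup>+x. indicator A (x - y) * indicator B x \<partial>N \<partial>lborel) =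
        (\<integral>\<^sup>+y. \<integral>\<^sup>+x. indicator A x * indicator B (x + y) \<partial>N \<partial>lborel)"
    proof (rule nn_integral_cong)
      fix y
      show "(\<integral>\<^sup>+x. indicator A (x - y) * indicator B x \<partial>N) =
          (\<integral>\<^sup>+x. indicator A x * (indicator B (x + y) :: ennreal) \<partial>N)"
        using trans[of "\<lambda>x. indicator A x * indicator B (x + y)" y] by simp
    qed
    also have "\<dots> = (\<integral>\<^sup>+x. \<integral>\<^sup>+y. indicator A x * indicator B (x + y) \<partial>lborel \<partial>N)"
      by (rule P.Fubini') measurable
    also have "\<dots> = (\<integral>\<^sup>+x. indicator A x * (\<integral>\<^sup>+y. indicator B (x + y) \<partial>lborel) \<partial>N)"
      by (simp add: nn_integral_cmult)
    also have "\<dots> = (\<integral>\<^sup>+x. indicator A x * emeasure lborel B \<partial>N)"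
      by (simp add: nn_integral_lborel_translate)
    also have "\<dots> = emeasure N A * emeasure lborel B"
      by (simp add: nn_integral_multc)
    finally have "emeasure N A * emeasure lborel B = emeasure lborel A * emeasure lborel B"
      using 1 NB by (simp add: B_def)
    then show ?thesis
      using fin pos by (auto simp: B_def ennreal_mult_cancel_left less_top mult.commute[of _ "emeasure lborel (ball 0 1)"])
  qed
  then show ?thesis
    by (intro measure_eqI) (auto simp: N_def)
qed

lemma nn_integral_lborel_isometry:
  fixes f :: "'a::euclidean_space \<Rightarrow> 'a"
  assumes "orthogonal_transformation f" and [measurable]: "g \<in> borel_measurable borel"
  shows "(\<integral>\<^sup>+x. g (f x) \<partial>lborel) = (\<integral>\<^sup>+x. g x \<partial>lborel)"
proof -
  have lin: "linear f"
    using assms by (auto simp: orthogonal_transformation_def)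
  have [measurable]: "f \<in> borel_measurable borel"
    by (intro borel_measurable_continuous_onI linear_continuous_on linear_conv_bounded_linear[THEN iffD1] lin)
  have "(\<integral>\<^sup>+x. g x \<partial>lborel) = (\<integral>\<^sup>+x. g x \<partial>distr lborel borel f)"
    by (simp add: distr_lborel_isometry[OF assms(1)])
  then show ?thesis by (simp add: nn_integral_distr)
qed

lemma nn_integral_lborel_diag:
  fixes d :: "real^'n"
  assumes d: "\<And>i. d $ i \<noteq> 0" and [measurable]: "g \<in> borel_measurable borel"
  shows "ennreal (\<Prod>i\<in>UNIV. \<bar>d $ i\<bar>) * (\<integral>\<^sup>+w. g (\<chi> i. d $ i * w $ i) \<partial>lborel) = (\<integral>\<^sup>+x. g x \<partial>lborel)"
proof -
  define T where "T = (\<lambda>w::real^'n. \<chi> i. d $ i * w $ i)"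
  have T: "T w = 0 + (\<Sum>j\<in>Basis. ((d \<bullet> j) * (w \<bullet> j)) *\<^sub>R j)" for w
  proof -
    have "T w = (\<Sum>j\<in>Basis. (T w \<bullet> j) *\<^sub>R j)" by (simp add: euclidean_representation)
    also have "\<dots> = (\<Sum>j\<in>Basis. ((d \<bullet> j) * (w \<bullet> j)) *\<^sub>R j)"
      by (rule sum.cong) (auto simp: Basis_vec_def T_def inner_axis)
    finally show ?thesis by simp
  qed
  have inj: "inj (\<lambda>i::'n. axis i (1::real))" by (auto simp: inj_on_def axis_eq_axis)
  have Bas: "(Basis :: (real^'n) set) = range (\<lambda>i. axis i 1)" by (auto simp: Basis_vec_def)
  have prd: "(\<Prod>j\<in>Basis. \<bar>d \<bullet> j\<bar>) = (\<Prod>i\<in>UNIV. \<bar>d $ i\<bar>)"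
    unfolding Bas by (subst prod.reindex[OF inj]) (simp add: inner_axis)
  have T': "T = (\<lambda>w. 0 + (\<Sum>j\<in>Basis. ((d \<bullet> j) * (w \<bullet> j)) *\<^sub>R j))"
    using T by (rule ext)
  have "lborel = density (distr lborel borel T) (\<lambda>_. ennreal (\<Prod>j\<in>Basis. \<bar>d \<bullet> j\<bar>))"
    unfolding T' by (rule lborel_affine_euclidean) (use d in \<open>auto simp: Basis_vec_def inner_axis\<close>)
  then have "(\<integral>\<^sup>+x. g x \<partial>lborel) =
      (\<integral>\<^sup>+x. g x \<partial>density (distr lborel borel T) (\<lambda>_. ennreal (\<Prod>i\<in>UNIV. \<bar>d $ i\<bar>)))"
    by (simp add: prd)
  moreover have [measurable]: "T \<in> borel_measurable borel"
    unfolding T' by measurable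
  ultimately show ?thesis
    by (simp add: nn_integral_density nn_integral_distr nn_integral_cmult T_def)
qed

section \<open>Reduction of the linear operators to a kernel independent of the matrix\<close>

text \<open>With the roots of the eigenvalues of M as \<open>d\<close>, this is the root of M
  applied to Q w. Substituting it for y turns the distorted norm in the kernel into
  \<open>norm w\<close>.\<close>

definition conj_vec :: "real^'n^'n \<Rightarrow> real^'n \<Rightarrow> real^'n \<Rightarrow> real^'n" where
  "conj_vec Q d w = Q *v (\<chi> i. d $ i * w $ i)"

lemma continuous_on_conj_vec [continuous_intros]: "continuous_on A (conj_vec Q d)"
  unfolding conj_vec_def
  by (rule continuous_on_compose2[OF matrix_vector_mult_linear_continuous_on[of UNIV Q]])
     (auto intro!: continuous_intros)

lemma borel_measurable_conj_vec [measurable]: "conj_vec Q d \<in> borel_measurable borel"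
  by (intro borel_measurable_continuous_onI continuous_intros)

lemma nn_integral_lborel_conj_vec:
  assumes Q: "orthogonal_matrix Q" and d: "\<And>i. d $ i > 0"
    and [measurable]: "g \<in> borel_measurable borel"
  shows "(\<integral>\<^sup>+x. g x \<partial>lborel) = ennreal (\<Prod>i\<in>UNIV. d $ i) * (\<integral>\<^sup>+w. g (conj_vec Q d w) \<partial>lborel)"
proof -
  have ot: "orthogonal_transformation ((*v) Q)"
    using Q by (simp add: orthogonal_transformation_matrix)
  have [measurable]: "(*v) Q \<in> borel_measurable borel"
    by (intro borel_measurable_continuous_onI matrix_vector_mult_linear_continuous_on)
  have "(\<integral>\<^sup>+x. g x \<partial>lborel) = (\<integral>\<^sup>+x. g (Q *v x) \<partial>lborel)"
    by (rule nn_integral_lborel_isometry[OF ot, symmetric]) simp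
  also have "\<dots> = ennreal (\<Prod>i\<in>UNIV. \<bar>d $ i\<bar>) * (\<integral>\<^sup>+w. g (Q *v (\<chi> i. d $ i * w $ i)) \<partial>lborel)"
    by (rule nn_integral_lborel_diag[symmetric]) (use d in \<open>auto simp: less_imp_neq[symmetric]\<close>)
  finally show ?thesis
    using d by (simp add: conj_vec_def less_imp_le)
qed

text \<open>The integrand after the substitution y = T w: the weight is the same for all matrices,
  which enter only through \<open>T\<close>.\<close>

definition frac_int :: "real \<Rightarrow> (real^'n \<Rightarrow> real) \<Rightarrow> real^'n \<Rightarrow> (real^'n \<Rightarrow> real^'n) \<Rightarrow> real^'n \<Rightarrow> real" where
  "frac_int s u x T w = second_diff u x (T w) / norm w powr (real CARD('n) + 2 * s)"

text \<open>The Jacobian of the substitution is the product \<open>D\<close> of the entries of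
  \<open>d\<close>; it cancels the determinant \<open>1 / D\<close> in the kernel.\<close>

lemma frac_linear_conj_diag:
  fixes v :: "real^'n \<Rightarrow> real"
  assumes Q: "orthogonal_matrix Q" and m: "\<And>i. m $ i > 0"
    and [measurable]: "v \<in> borel_measurable borel"
  shows "frac_linear s (conj_diag Q m) v x =
    ereal (1/2) * ext_integral (frac_int s v x (conj_vec Q (\<chi> i. sqrt (m $ i))))"
proof -
  define d where "d = (\<chi> i. sqrt (m $ i))"
  have d: "d $ i > 0" for i using m by (simp add: d_def)
  define D where "D = (\<Prod>i\<in>UNIV. d $ i)"
  have D: "D > 0" using d by (simp add: D_def prod_pos)
  define R where "R = matrix_inv (matrix_sqrt (conj_diag Q m))"
  have R: "R = conj_diag Q (\<chi> i. 1 / d $ i)"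
    using m by (simp add: R_def matrix_sqrt_conj_diag[OF Q] matrix_inv_conj_diag[OF Q] d_def less_imp_neq[symmetric])
  have detR: "det R = 1 / D"
    by (simp add: R det_conj_diag[OF Q] D_def prod_dividef)
  have Rw: "norm (R *v conj_vec Q d w) = norm w" for w
  proof -
    have "R *v conj_vec Q d w = Q *v (\<chi> i. 1 / d $ i * (d $ i * w $ i))"
      by (simp add: R conj_vec_def conj_diag_mult_vec[OF Q])
    also have "(\<chi> i. 1 / d $ i * (d $ i * w $ i)) = w"
      using d by (simp add: vec_eq_iff less_imp_neq[symmetric])
    finally show ?thesis by (simp add: norm_orthogonal_matrix[OF Q])
  qed
  define F where "F = (\<lambda>y. second_diff v x y / norm (R *v y) powr (real CARD('n) + 2 * s) * det R)"
  have [measurable]: "(*v) R \<in> borel_measurable borel"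
    by (intro borel_measurable_continuous_onI matrix_vector_mult_linear_continuous_on)
  have [measurable]: "F \<in> borel_measurable borel"
    unfolding F_def second_diff_def by measurable
  have F: "F (conj_vec Q d w) = frac_int s v x (conj_vec Q d) w / D" for w
    by (simp add: F_def Rw detR frac_int_def)
  \<comment> \<open>The values 1 and -1 of \<open>c\<close> give the positive and the negative part,
    from which \<open>ext_integral\<close> is formed.\<close>
  have sc: "(\<integral>\<^sup>+y. ennreal (c * F y) \<partial>lborel) = (\<integral>\<^sup>+w. ennreal (c * frac_int s v x (conj_vec Q d) w) \<partial>lborel)"
    for c
  proof -
    have "(\<integral>\<^sup>+y. ennreal (c * F y) \<partial>lborel) =
        ennreal D * (\<integral>\<^sup>+w. ennreal (c * F (conj_vec Q d w)) \<partial>lborel)"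
      unfolding D_def by (rule nn_integral_lborel_conj_vec[OF Q d]) simp
    also have "\<dots> = (\<integral>\<^sup>+w. ennreal D * ennreal (c * F (conj_vec Q d w)) \<partial>lborel)"
      by (rule nn_integral_cmult[symmetric]) simp
    also have "\<dots> = (\<integral>\<^sup>+w. ennreal (c * frac_int s v x (conj_vec Q d) w) \<partial>lborel)"
      using D by (simp add: F ennreal_mult'[symmetric])
    finally show ?thesis .
  qed
  have "ext_integral F = ext_integral (frac_int s v x (conj_vec Q d))"
    unfolding ext_integral_def using sc[of 1] sc[of "-1"] by simp
  then show ?thesis
    by (simp add: frac_linear_def F_def R_def d_def)
qed

section \<open>The fractional kernel and semi-concave functions\<close>

text \<open>The integrand is dominated by the sum of \<open>c k\<close> times the indicators of the
  balls of radius \<open>r k\<close>, whose volumes are proportional to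
  \<open>r k ^ DIM('a)\<close>.\<close>

lemma nn_integral_finite_of_ball_cover:
  fixes f :: "'a::euclidean_space \<Rightarrow> real" and c r :: "nat \<Rightarrow> real"
  assumes r: "\<And>k. r k \<ge> 0" and c: "\<And>k. c k \<ge> 0"
    and cover: "\<And>w. f w > 0 \<Longrightarrow> \<exists>k. norm w < r k \<and> f w \<le> c k"
    and sum: "summable (\<lambda>k. c k * r k ^ DIM('a))"
  shows "(\<integral>\<^sup>+w. ennreal (f w) \<partial>lborel) < \<infinity>"
proof -
  have "ennreal (f w) \<le> (\<Sum>k. ennreal (c k) * indicator (ball 0 (r k)) w)" for w
  proof (cases "f w > 0")
    case True
    then obtain k where k: "norm w < r k" "f w \<le> c k" using cover by blast
    then have "ennreal (f w) \<le> ennreal (c k) * indicator (ball 0 (r k)) w"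
      by (simp add: indicator_def ennreal_leI)
    also have "\<dots> \<le> (\<Sum>k. ennreal (c k) * indicator (ball 0 (r k)) w)"
    proof -
      define g where "g = (\<lambda>k. ennreal (c k) * indicator (ball 0 (r k)) w)"
      have "sum g {k} \<le> suminf g" by (rule sum_le_suminf) auto
      then have "g k \<le> suminf g" by simp
      then show ?thesis by (simp only: g_def)
    qed
    finally show ?thesis .
  qed (simp add: ennreal_neg)
  then have "(\<integral>\<^sup>+w. ennreal (f w) \<partial>lborel) \<le>
      (\<integral>\<^sup>+w. (\<Sum>k. ennreal (c k) * indicator (ball 0 (r k)) (w :: 'a)) \<partial>lborel)"
    by (intro nn_integral_mono)
  also have "\<dots> = (\<Sum>k. \<integral>\<^sup>+w. ennreal (c k) * indicator (ball 0 (r k)) (w :: 'a) \<partial>lborel)"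
    by (intro nn_integral_suminf borel_measurable_times_ennreal borel_measurable_const
        borel_measurable_indicator) simp
  also have "\<dots> = (\<Sum>k. ennreal (unit_ball_vol DIM('a) * (c k * r k ^ DIM('a))))"
    using r c by (simp add: nn_integral_cmult_indicator emeasure_ball ennreal_mult[symmetric] mult_ac)
  also have "\<dots> = ennreal (\<Sum>k. unit_ball_vol DIM('a) * (c k * r k ^ DIM('a)))"
    using r c sum by (intro suminf_ennreal2 summable_mult mult_nonneg_nonneg) auto
  also have "\<dots> < \<infinity>" by simp
  finally show ?thesis .
qed

text \<open>The common majorant of all integrands up to constants: semi-concavity gives the
  quadratic branch near the origin, the Lipschitz bound the linear branch far away.\<close>

definition frac_bound :: "real \<Rightarrow> 'a::euclidean_space \<Rightarrow> real" where
  "frac_bound s w = min ((norm w)\<^sup>2) (norm w) / norm w powr (real DIM('a) + 2 * s)"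

lemma frac_bound_nonneg: "frac_bound s w \<ge> 0"
  by (simp add: frac_bound_def)

text \<open>Dyadic shells inside the unit ball contribute terms of a geometric series with ratio
  2^(2 s - 2), those outside one with ratio 2^(1 - 2 s). The two series need s < 1 and s > 1/2
  respectively.\<close>

lemma integrable_frac_bound:
  assumes s: "1/2 < s" "s < 1"
  shows "integrable lborel (frac_bound s :: 'a::euclidean_space \<Rightarrow> real)"
proof -
  define n where "n = real DIM('a)"
  define p where "p = n + 2 * s"
  have p: "p > 0" using s by (simp add: p_def n_def add_nonneg_pos)
  define f1 where "f1 = (\<lambda>w::'a. if norm w < 1 then frac_bound s w else 0)"
  define f2 where "f2 = (\<lambda>w::'a. if norm w < 1 then 0 else frac_bound s w)"
  have [measurable]: "(frac_bound s :: 'a \<Rightarrow> real) \<in> borel_measurable borel"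
    unfolding frac_bound_def[abs_def] by measurable
  have geo: "summable (\<lambda>k. 2 powr (a + real k * b))" if "b < 0" for a b :: real
  proof -
    have "(\<lambda>k. 2 powr (a + real k * b)) = (\<lambda>k. 2 powr a * (2 powr b) ^ k)"
      by (simp add: powr_add powr_powr[symmetric] powr_realpow[symmetric] mult.commute)
    moreover have "2 powr b < 1" using that by (simp add: powr_less_one)
    ultimately show ?thesis by (simp add: summable_mult summable_geometric)
  qed
  have "(\<integral>\<^sup>+w. ennreal (f1 w) \<partial>lborel) < \<infinity>"
  proof (rule nn_integral_finite_of_ball_cover)
    \<comment> \<open>On the shell 2^-(k+1) < |w| <= 2^-k the numerator is taken at the outer radius
      and the denominator at the inner one. The radius \<open>r k\<close> is one dyadic step larger
      because the balls are open.\<close>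
    define c where "c = (\<lambda>k::nat. 2 powr (- 2 * real k + p * (real k + 1)))"
    define r where "r = (\<lambda>k::nat. 2 powr (1 - real k))"
    show "r k \<ge> 0" "c k \<ge> 0" for k by (auto simp: c_def r_def)
    have "c k * r k ^ DIM('a) = 2 powr ((p + n) + real k * (2 * s - 2))" for k
      by (simp add: c_def r_def n_def p_def powr_realpow[symmetric] powr_powr powr_add[symmetric] algebra_simps)
    then show "summable (\<lambda>k. c k * r k ^ DIM('a))"
      using geo[of "2 * s - 2" "p + n"] s by simp
    fix w :: 'a assume "f1 w > 0"
    then have w: "norm w < 1" "norm w > 0" by (auto simp: f1_def frac_bound_def split: if_splits)
    define l where "l = - log 2 (norm w)"
    have l: "norm w = 2 powr (- l)" "l > 0"
      using w by (auto simp: l_def log_less_zero_cancel_iff)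
    define k where "k = nat \<lfloor>l\<rfloor>"
    have k: "real k \<le> l" "l < real k + 1" using l(2) by (auto simp: k_def)
    have "norm w < r k" using k unfolding l r_def by (intro powr_less_mono) auto
    moreover have "f1 w \<le> c k"
    proof -
      have "f1 w \<le> (norm w)\<^sup>2 / norm w powr p"
        using w by (auto simp: f1_def frac_bound_def p_def n_def intro!: divide_right_mono)
      also have "\<dots> = 2 powr (- 2 * l + p * l)"
        by (simp add: l powr_realpow[symmetric] powr_powr powr_diff[symmetric] algebra_simps)
      also have "\<dots> \<le> c k"
      proof -
        have "p * l \<le> p * (real k + 1)" using k p by (intro mult_left_mono) auto
        then show ?thesis unfolding c_def using k by (intro powr_mono) auto
      qed
      finally show ?thesis .
    qed
    ultimately show "\<exists>k. norm w < r k \<and> f1 w \<le> c k" by blast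
  qed
  moreover have "(\<integral>\<^sup>+w. ennreal (f2 w) \<partial>lborel) < \<infinity>"
  proof (rule nn_integral_finite_of_ball_cover)
    define c where "c = (\<lambda>k::nat. 2 powr ((real k + 1) - p * real k))"
    define r where "r = (\<lambda>k::nat. 2 powr (real k + 1))"
    show "r k \<ge> 0" "c k \<ge> 0" for k by (auto simp: c_def r_def)
    have "c k * r k ^ DIM('a) = 2 powr ((1 + n) + real k * (1 - 2 * s))" for k
      by (simp add: c_def r_def n_def p_def powr_realpow[symmetric] powr_powr powr_add[symmetric] algebra_simps)
    then show "summable (\<lambda>k. c k * r k ^ DIM('a))"
      using geo[of "1 - 2 * s" "1 + n"] s by simp
    fix w :: 'a assume "f2 w > 0"
    then have w: "norm w \<ge> 1" by (auto simp: f2_def split: if_splits)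
    define l where "l = log 2 (norm w)"
    have "norm w > 0" using w by linarith
    then have l: "norm w = 2 powr l" "l \<ge> 0"
      using w by (simp_all add: l_def del: zero_less_norm_iff)
    define k where "k = nat \<lfloor>l\<rfloor>"
    have k: "real k \<le> l" "l < real k + 1" using l(2) by (auto simp: k_def)
    have "norm w < r k" using k unfolding l r_def by (intro powr_less_mono) auto
    moreover have "f2 w \<le> c k"
    proof -
      have "f2 w \<le> norm w / norm w powr p"
        using w by (auto simp: f2_def frac_bound_def p_def n_def intro!: divide_right_mono)
      also have "\<dots> = 2 powr (l - p * l)"
        by (simp add: l powr_powr powr_diff[symmetric] mult.commute)
      also have "\<dots> \<le> c k"
        unfolding c_def using k p by (intro powr_mono diff_mono mult_left_mono) auto
      finally show ?thesis .
    qed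
    ultimately show "\<exists>k. norm w < r k \<and> f2 w \<le> c k" by blast
  qed
  moreover have "(\<integral>\<^sup>+w. ennreal (frac_bound s w) \<partial>(lborel :: 'a measure)) =
      (\<integral>\<^sup>+w. ennreal (f1 w) \<partial>lborel) + (\<integral>\<^sup>+w. ennreal (f2 w) \<partial>(lborel :: 'a measure))"
    unfolding f1_def f2_def
    by (subst nn_integral_add[symmetric]) (auto intro!: nn_integral_cong)
  ultimately have "(\<integral>\<^sup>+w. ennreal (frac_bound s w) \<partial>(lborel :: 'a measure)) < \<infinity>"
    by simp
  then show ?thesis
    by (intro integrableI_nonneg) (auto simp: frac_bound_nonneg)
qed

section \<open>Convexity and supergradients of semi-concave functions\<close>

text \<open>Let \<open>h\<close> be the difference to the chord. If its maximum were positive, the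
  leftmost maximiser \<open>t0\<close> would be interior, and the midpoint inequality at
  \<open>t0 - d\<close> and \<open>t0 + d\<close> would make \<open>t0 - d\<close> a maximiser as
  well.\<close>

lemma midpoint_convex_imp_convex_on:
  fixes \<phi> :: "'a::real_normed_vector \<Rightarrow> real"
  assumes cont: "continuous_on UNIV \<phi>" and mid: "\<And>x y. second_diff \<phi> x y \<ge> 0"
  shows "convex_on UNIV \<phi>"
proof (rule convex_onI)
  fix t :: real and a b :: 'a
  assume t: "0 < t" "t < 1"
  define h where "h = (\<lambda>\<tau>. \<phi> ((1 - \<tau>) *\<^sub>R a + \<tau> *\<^sub>R b) - ((1 - \<tau>) * \<phi> a + \<tau> * \<phi> b))"
  have ch: "continuous_on {0..1} h"
    unfolding h_def
    by (intro continuous_intros continuous_on_compose2[OF cont]) auto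
  obtain m where m: "m \<in> {0..1}" "\<And>\<tau>. \<tau> \<in> {0..1} \<Longrightarrow> h \<tau> \<le> h m"
    using continuous_attains_sup[OF compact_Icc _ ch] by auto
  have "h m \<le> 0"
  proof (rule ccontr)
    assume "\<not> h m \<le> 0"
    define S where "S = {0..1} \<inter> h -` {h m}"
    have "closed S"
      unfolding S_def by (rule continuous_closed_preimage[OF ch]) auto
    then have "compact S"
      unfolding S_def by (metis compact_Icc closed_Int_compact inf.idem inf_assoc inf_commute)
    moreover have "S \<noteq> {}" using m by (auto simp: S_def)
    ultimately obtain t0 where t0: "t0 \<in> S" "\<And>\<tau>. \<tau> \<in> S \<Longrightarrow> t0 \<le> \<tau>"
      using compact_attains_inf[of S] by blast
    have "h 0 = 0" "h 1 = 0" by (simp_all add: h_def)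
    then have "t0 \<noteq> 0" "t0 \<noteq> 1" using t0(1) \<open>\<not> h m \<le> 0\<close> by (auto simp: S_def)
    then have t01: "0 < t0" "t0 < 1" using t0(1) by (auto simp: S_def)
    define d where "d = min t0 (1 - t0)"
    have d: "d > 0" "t0 - d \<ge> 0" "t0 + d \<le> 1" using t01 by (auto simp: d_def)
    have "h (t0 + d) + h (t0 - d) - 2 * h t0 =
        second_diff \<phi> ((1 - t0) *\<^sub>R a + t0 *\<^sub>R b) (d *\<^sub>R (b - a))"
    proof -
      have "(1 - (t0 + d)) *\<^sub>R a + (t0 + d) *\<^sub>R b = ((1 - t0) *\<^sub>R a + t0 *\<^sub>R b) + d *\<^sub>R (b - a)"
        "(1 - (t0 - d)) *\<^sub>R a + (t0 - d) *\<^sub>R b = ((1 - t0) *\<^sub>R a + t0 *\<^sub>R b) - d *\<^sub>R (b - a)"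
        by (simp_all add: algebra_simps)
      then show ?thesis
        unfolding h_def second_diff_def by (simp only:) (simp add: algebra_simps)
    qed
    with mid have "h (t0 + d) + h (t0 - d) \<ge> 2 * h m"
      using t0(1) by (metis (no_types, lifting) IntD2 S_def diff_ge_0_iff_ge singletonD vimageE)
    moreover have "h (t0 + d) \<le> h m" "h (t0 - d) \<le> h m" using d t01 by (auto intro!: m)
    ultimately have "t0 - d \<in> S" using d t01 by (auto simp: S_def)
    with t0(2) d show False by force
  qed
  then have "h t \<le> 0" using m(2)[of t] t by auto
  then show "\<phi> ((1 - t) *\<^sub>R a + t *\<^sub>R b) \<le> (1 - t) * \<phi> a + t * \<phi> b"
    by (simp add: h_def)
qed simp

text \<open>A hyperplane separates the point (x, \<phi> x) from the strict epigraph. It is not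
  vertical because \<phi> is finite on the whole space, so it is the graph of an affine function. A
  small margin above \<phi> y recovers the inequality on the graph itself.\<close>

lemma convex_on_subgradient:
  fixes \<phi> :: "'a::euclidean_space \<Rightarrow> real"
  assumes conv: "convex_on UNIV \<phi>"
  obtains p where "\<And>y. \<phi> y \<ge> \<phi> x + p \<bullet> (y - x)"
proof -
  define E where "E = {z :: 'a \<times> real. \<phi> (fst z) < snd z}"
  have "convex E"
  proof (rule convexI)
    fix z w :: "'a \<times> real" and u v :: real
    assume zw: "z \<in> E" "w \<in> E" and uv: "0 \<le> u" "0 \<le> v" "u + v = 1"
    have "\<phi> (u *\<^sub>R fst z + v *\<^sub>R fst w) \<le> u * \<phi> (fst z) + v * \<phi> (fst w)"
      using conv uv by (simp add: convex_on_def)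
    also have "\<dots> < u * snd z + v * snd w"
    proof (cases "u = 0")
      case True then show ?thesis using zw uv by (simp add: E_def)
    next
      case False
      then have "u * \<phi> (fst z) < u * snd z" using zw uv by (simp add: E_def)
      moreover have "v * \<phi> (fst w) \<le> v * snd w" using zw uv by (intro mult_left_mono) (auto simp: E_def)
      ultimately show ?thesis by linarith
    qed
    finally show "u *\<^sub>R z + v *\<^sub>R w \<in> E" by (simp add: E_def)
  qed
  moreover have "E \<noteq> {}" by (auto simp: E_def intro!: exI[of _ x] exI[of _ "\<phi> x + 1"])
  moreover have "{(x, \<phi> x)} \<inter> E = {}" by (auto simp: E_def)
  ultimately obtain a b where "a \<noteq> 0" "\<forall>z\<in>{(x, \<phi> x)}. a \<bullet> z \<le> b" "\<forall>z\<in>E. a \<bullet> z \<ge> b"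
    using separating_hyperplane_sets[OF convex_singleton, of E "(x, \<phi> x)"] by blast
  then have a: "a \<noteq> 0" "a \<bullet> (x, \<phi> x) \<le> b" "\<And>z. z \<in> E \<Longrightarrow> a \<bullet> z \<ge> b" by auto
  obtain q c where qc: "a = (q, c)" by (cases a)
  have ineq: "q \<bullet> (y - x) + c * (t - \<phi> x) \<ge> 0" if "\<phi> y < t" for y t
    using a(3)[of "(y, t)"] a(2) that by (simp add: E_def qc inner_diff_right algebra_simps)
  have "c \<ge> 0" using ineq[of x "\<phi> x + 1"] by simp
  have "c \<noteq> 0"
  proof
    assume "c = 0"
    then have "q \<bullet> (- q) \<ge> 0" using ineq[of "x - q" "\<phi> (x - q) + 1"] by simp
    then have "q \<bullet> q = 0" using inner_ge_zero[of q] by simp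
    then have "q = 0" by simp
    with \<open>c = 0\<close> a(1) qc show False by (simp add: zero_prod_def)
  qed
  then have c: "c > 0" using \<open>c \<ge> 0\<close> by simp
  have supp: "q \<bullet> (y - x) + c * (\<phi> y - \<phi> x) \<ge> 0" for y
  proof (rule ccontr)
    assume neg: "\<not> ?thesis"
    define e where "e = - (q \<bullet> (y - x) + c * (\<phi> y - \<phi> x))"
    have "e > 0" using neg by (simp add: e_def)
    then have "\<phi> y < \<phi> y + e / (2 * c)" using c by simp
    note ineq[OF this]
    moreover have "c * (\<phi> y + e / (2 * c) - \<phi> x) = c * (\<phi> y - \<phi> x) + e / 2"
      using c by (simp add: algebra_simps)
    ultimately have "0 \<le> - e + e / 2" by (simp add: e_def)
    with \<open>e > 0\<close> show False by simp
  qed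
  have "\<phi> y \<ge> \<phi> x + ((-1 / c) *\<^sub>R q) \<bullet> (y - x)" for y
  proof -
    have "0 \<le> (q \<bullet> (y - x) + c * (\<phi> y - \<phi> x)) / c" using supp[of y] c by (intro divide_nonneg_pos)
    moreover have "(q \<bullet> (y - x) + c * (\<phi> y - \<phi> x)) / c = q \<bullet> (y - x) / c + (\<phi> y - \<phi> x)"
      using c by (simp add: add_divide_distrib)
    moreover have "((-1 / c) *\<^sub>R q) \<bullet> (y - x) = - (q \<bullet> (y - x) / c)" by simp
    ultimately show ?thesis by linarith
  qed
  then show thesis by (rule that)
qed

lemma semiconcave_convex:
  fixes u :: "'a::real_inner \<Rightarrow> real"
  assumes "semiconcave C u"
  shows "convex_on UNIV (\<lambda>y. C / 2 * (norm y)\<^sup>2 - u y)"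
proof (rule midpoint_convex_imp_convex_on)
  show "continuous_on UNIV (\<lambda>y. C / 2 * (norm y)\<^sup>2 - u y)"
    using assms by (auto simp: semiconcave_def intro!: continuous_intros)
  fix x y
  have "second_diff (\<lambda>y. C / 2 * (norm y)\<^sup>2 - u y) x y = C * (norm y)\<^sup>2 - second_diff u x y"
    by (simp add: second_diff_def power2_norm_eq_inner inner_add_left inner_add_right inner_diff_left
        inner_diff_right inner_commute) (simp add: field_simps)
  then show "second_diff (\<lambda>y. C / 2 * (norm y)\<^sup>2 - u y) x y \<ge> 0"
    using assms by (simp add: semiconcave_def)
qed

text \<open>A subgradient \<open>q\<close> of the convex function of
  \<open>semiconcave_convex\<close> is used; expanding the square about \<open>x\<close> changes the
  slope to \<open>C *\<^sub>R x - q\<close>.\<close>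

lemma semiconcave_supergradient:
  fixes u :: "'a::euclidean_space \<Rightarrow> real"
  assumes "semiconcave C u"
  obtains p where "\<And>y. u y \<le> u x + p \<bullet> (y - x) + C / 2 * (norm (y - x))\<^sup>2"
proof -
  obtain q where q: "\<And>y. C / 2 * (norm y)\<^sup>2 - u y \<ge> C / 2 * (norm x)\<^sup>2 - u x + q \<bullet> (y - x)"
    using convex_on_subgradient[OF semiconcave_convex[OF assms], where x=x] by blast
  have "u y \<le> u x + (C *\<^sub>R x - q) \<bullet> (y - x) + C / 2 * (norm (y - x))\<^sup>2" for y
  proof -
    have "C / 2 * (norm y)\<^sup>2 - C / 2 * (norm x)\<^sup>2 = (C *\<^sub>R x) \<bullet> (y - x) + C / 2 * (norm (y - x))\<^sup>2"
      by (simp add: power2_norm_eq_inner inner_diff_left inner_diff_right inner_commute) (simp add: field_simps)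
    then show ?thesis using q[of y] by (simp add: inner_diff_left)
  qed
  then show thesis by (rule that)
qed

section \<open>One-sided bounds on second differences\<close>

lemma second_diff_upper:
  fixes u :: "'a::real_normed_vector \<Rightarrow> real"
  assumes lip: "L-lipschitz_on UNIV u" and sc: "semiconcave C u"
  shows "second_diff u x y \<le> (C + 2 * L) * min ((norm y)\<^sup>2) (norm y)"
proof -
  have L: "L \<ge> 0" using lip by (rule lipschitz_on_nonneg)
  have C: "C \<ge> 0" using sc by (simp add: semiconcave_def)
  have "dist (u (x + y)) (u x) \<le> L * norm y" "dist (u (x - y)) (u x) \<le> L * norm y"
    using lipschitz_onD[OF lip, of "x + y" x] lipschitz_onD[OF lip, of "x - y" x] by (simp_all add: dist_norm)
  then have 1: "second_diff u x y \<le> 2 * L * norm y"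
    by (simp add: second_diff_def dist_real_def)
  have 2: "second_diff u x y \<le> C * (norm y)\<^sup>2" using sc by (simp add: semiconcave_def)
  show ?thesis
  proof (cases "(norm y)\<^sup>2 \<le> norm y")
    case True
    have "C * (norm y)\<^sup>2 \<le> (C + 2 * L) * (norm y)\<^sup>2" using L by (intro mult_right_mono) auto
    with 2 True show ?thesis by (simp add: min_def)
  next
    case False
    have "2 * L * norm y \<le> (C + 2 * L) * norm y" using C by (intro mult_right_mono) auto
    with 1 False show ?thesis by (simp add: min_def)
  qed
qed

text \<open>The inner points are convex combinations of the outer ones, so convexity of C/2 |y|^2 -
  u bounds the increase of the even part by the quadratic term. For large steps the Lipschitz bound
  is better.\<close>

lemma even_part_decreasing:
  fixes u :: "'a::real_inner \<Rightarrow> real"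
  assumes lip: "L-lipschitz_on UNIV u" and sc: "semiconcave C u"
    and ab: "0 \<le> b" "b \<le> a" and q: "norm q = 1"
  shows "u (p + (a * t) *\<^sub>R q) + u (p - (a * t) *\<^sub>R q) \<le>
    u (p + (b * t) *\<^sub>R q) + u (p - (b * t) *\<^sub>R q) + (C + 2 * L) * min ((a * t)\<^sup>2) \<bar>a * t\<bar>"
proof (cases "a = 0")
  case False
  then have a: "a > 0" using ab by simp
  have L: "L \<ge> 0" using lip by (rule lipschitz_on_nonneg)
  have C: "C \<ge> 0" using sc by (simp add: semiconcave_def)
  let ?D = "u (p + (a * t) *\<^sub>R q) + u (p - (a * t) *\<^sub>R q) - (u (p + (b * t) *\<^sub>R q) + u (p - (b * t) *\<^sub>R q))"
  have dt: "\<bar>a * t - b * t\<bar> \<le> \<bar>a * t\<bar>"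
  proof -
    have "\<bar>a * t - b * t\<bar> = (a - b) * \<bar>t\<bar>" using ab by (simp add: left_diff_distrib[symmetric] abs_mult)
    also have "\<dots> \<le> a * \<bar>t\<bar>" using ab by (intro mult_right_mono) auto
    finally show ?thesis using a by (simp add: abs_mult)
  qed
  have "dist (u (p + (a * t) *\<^sub>R q)) (u (p + (b * t) *\<^sub>R q)) \<le> L * \<bar>a * t - b * t\<bar>"
    using lipschitz_onD[OF lip, of "p + (a * t) *\<^sub>R q" "p + (b * t) *\<^sub>R q"] q
    by (simp add: dist_norm scaleR_diff_left[symmetric])
  moreover have "dist (u (p - (a * t) *\<^sub>R q)) (u (p - (b * t) *\<^sub>R q)) \<le> L * \<bar>a * t - b * t\<bar>"
    using lipschitz_onD[OF lip, of "p - (a * t) *\<^sub>R q" "p - (b * t) *\<^sub>R q"] q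
    by (simp add: dist_norm scaleR_diff_left[symmetric] norm_minus_commute abs_minus_commute)
  moreover have "L * \<bar>a * t - b * t\<bar> \<le> L * \<bar>a * t\<bar>" using dt L by (rule mult_left_mono)
  ultimately have 1: "?D \<le> 2 * L * \<bar>a * t\<bar>" by (simp add: dist_real_def)
  define \<phi> where "\<phi> = (\<lambda>y. C / 2 * (norm y)\<^sup>2 - u y)"
  have conv: "convex_on UNIV \<phi>" unfolding \<phi>_def by (rule semiconcave_convex[OF sc])
  \<comment> \<open>The weight for which l a - (1 - l) a = b, so both inner points use the weights
    \<open>l\<close> and \<open>1 - l\<close>.\<close>
  define l where "l = (1 + b / a) / 2"
  have l: "0 \<le> l" "l \<le> 1" using ab a by (auto simp: l_def)
  have la: "(2 * l - 1) * a = b" using a by (simp add: l_def field_simps)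
  have pt: "p + (b * t) *\<^sub>R q = l *\<^sub>R (p + (a * t) *\<^sub>R q) + (1 - l) *\<^sub>R (p - (a * t) *\<^sub>R q)"
    "p - (b * t) *\<^sub>R q = (1 - l) *\<^sub>R (p + (a * t) *\<^sub>R q) + l *\<^sub>R (p - (a * t) *\<^sub>R q)"
    unfolding la[symmetric] by (simp_all add: algebra_simps scaleR_2[symmetric] scaleR_scaleR)
  have "\<phi> (p + (b * t) *\<^sub>R q) \<le> l * \<phi> (p + (a * t) *\<^sub>R q) + (1 - l) * \<phi> (p - (a * t) *\<^sub>R q)"
    "\<phi> (p - (b * t) *\<^sub>R q) \<le> (1 - l) * \<phi> (p + (a * t) *\<^sub>R q) + l * \<phi> (p - (a * t) *\<^sub>R q)"
    unfolding pt using conv l by (simp_all add: convex_on_def)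
  then have *: "\<phi> (p + (b * t) *\<^sub>R q) + \<phi> (p - (b * t) *\<^sub>R q) \<le> \<phi> (p + (a * t) *\<^sub>R q) + \<phi> (p - (a * t) *\<^sub>R q)"
    by (simp add: algebra_simps)
  have par: "C / 2 * (norm (p + c *\<^sub>R q))\<^sup>2 + C / 2 * (norm (p - c *\<^sub>R q))\<^sup>2 = C * (norm p)\<^sup>2 + C * c\<^sup>2" for c
  proof -
    have "q \<bullet> q = 1" using q by (simp add: norm_eq_1)
    then show ?thesis
      by (simp add: power2_norm_eq_inner inner_add_left inner_add_right inner_diff_left inner_diff_right
          inner_commute) (simp add: power2_eq_square field_simps)
  qed
  have "?D \<le> C * (a * t)\<^sup>2 - C * (b * t)\<^sup>2"
    using * par[of "a * t"] par[of "b * t"] by (simp add: \<phi>_def)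
  moreover have "0 \<le> C * (b * t)\<^sup>2" using C by simp
  ultimately have 2: "?D \<le> C * (a * t)\<^sup>2" by linarith
  have "?D \<le> (C + 2 * L) * min ((a * t)\<^sup>2) \<bar>a * t\<bar>"
  proof (cases "(a * t)\<^sup>2 \<le> \<bar>a * t\<bar>")
    case True
    have "C * (a * t)\<^sup>2 \<le> (C + 2 * L) * (a * t)\<^sup>2" using L by (intro mult_right_mono) auto
    with 2 True show ?thesis by (simp add: min_def)
  next
    case False
    have "2 * L * \<bar>a * t\<bar> \<le> (C + 2 * L) * \<bar>a * t\<bar>" using C by (intro mult_right_mono) auto
    with 1 False show ?thesis by (simp add: min_def)
  qed
  then show ?thesis by linarith
qed (use ab in simp)

section \<open>From viscosity inequalities to integrals\<close>

lemma ext_integral_eq_integral: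
  assumes "integrable lborel f"
  shows "ext_integral f = ereal (integral\<^sup>L lborel f)"
proof -
  obtain a b where ab: "(\<integral>\<^sup>+y. ennreal (f y) \<partial>lborel) = ennreal a" "(\<integral>\<^sup>+y. ennreal (- f y) \<partial>lborel) = ennreal b"
    "a \<ge> 0" "b \<ge> 0"
    using assms unfolding real_integrable_def
    by (metis ennreal_cases infinity_ennreal_def)
  then show ?thesis
    using real_lebesgue_integral_def[OF assms] by (simp add: ext_integral_def enn2ereal_ennreal)
qed

text \<open>The majorant makes the positive part finite, and a real lower bound on the extended
  integral then excludes an infinite negative part.\<close>

lemma integrable_of_ext_integral:
  assumes [measurable]: "f \<in> borel_measurable borel" and B: "integrable lborel B"
    and le: "\<And>w. f w \<le> B w" and ge: "ereal c \<le> ext_integral f"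
  shows "integrable lborel f"
proof -
  have "(\<integral>\<^sup>+y. ennreal (f y) \<partial>lborel) \<le> (\<integral>\<^sup>+y. ennreal (B y) \<partial>lborel)"
    by (intro nn_integral_mono ennreal_leI le)
  also have "\<dots> < \<infinity>" using B by (auto simp: real_integrable_def less_top)
  finally have fin: "(\<integral>\<^sup>+y. ennreal (f y) \<partial>lborel) < \<infinity>" .
  then obtain a where a: "(\<integral>\<^sup>+y. ennreal (f y) \<partial>lborel) = ennreal a" "a \<ge> 0"
    by (cases "\<integral>\<^sup>+y. ennreal (f y) \<partial>lborel") auto
  have "(\<integral>\<^sup>+y. ennreal (- f y) \<partial>lborel) \<noteq> \<infinity>"
    using ge a by (auto simp: ext_integral_def enn2ereal_ennreal)
  with fin show ?thesis
    by (auto simp: real_integrable_def)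
qed

text \<open>Fatou for the nonnegative functions \<open>B - F j\<close>. No common lower bound on the
  \<open>F j\<close> is available, so the lower bounds on their integrals have to supply the
  integrability of the limit.\<close>

lemma Fatou_upper:
  fixes F :: "nat \<Rightarrow> 'a \<Rightarrow> real"
  assumes F: "\<And>j. integrable M (F j)" and B: "integrable M B"
    and [measurable]: "f \<in> borel_measurable M"
    and le: "\<And>j w. F j w \<le> B w" and lim: "\<And>w. (\<lambda>j. F j w) \<longlonglongrightarrow> f w"
    and ge: "\<And>j. c \<le> integral\<^sup>L M (F j)"
  shows "integrable M f \<and> c \<le> integral\<^sup>L M f"
proof -
  have [measurable]: "B \<in> borel_measurable M" "F j \<in> borel_measurable M" for j
    using B F by auto
  have fB: "f w \<le> B w" for w
    by (rule LIMSEQ_le_const2[OF lim]) (use le in auto)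
  have c: "0 \<le> integral\<^sup>L M B - c"
    using ge[of 0] integral_mono[OF F B le] by (metis diff_ge_0_iff_ge order_trans)
  have "(\<integral>\<^sup>+w. ennreal (B w - f w) \<partial>M) = (\<integral>\<^sup>+w. liminf (\<lambda>j. ennreal (B w - F j w)) \<partial>M)"
  proof (rule nn_integral_cong)
    fix w
    have "(\<lambda>j. ennreal (B w - F j w)) \<longlonglongrightarrow> ennreal (B w - f w)"
      by (intro tendsto_ennrealI tendsto_intros lim)
    then show "ennreal (B w - f w) = liminf (\<lambda>j. ennreal (B w - F j w))"
      by (rule lim_imp_Liminf[OF sequentially_bot, symmetric])
  qed
  also have "\<dots> \<le> liminf (\<lambda>j. \<integral>\<^sup>+w. ennreal (B w - F j w) \<partial>M)"
    by (rule nn_integral_liminf) simp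
  also have "\<dots> \<le> liminf (\<lambda>j. ennreal (integral\<^sup>L M B - c))"
  proof (rule Liminf_mono, rule always_eventually, rule allI)
    fix j
    have "(\<integral>\<^sup>+w. ennreal (B w - F j w) \<partial>M) = ennreal (integral\<^sup>L M (\<lambda>w. B w - F j w))"
      by (rule nn_integral_eq_integral) (use B F le in auto)
    also have "\<dots> \<le> ennreal (integral\<^sup>L M B - c)"
      using ge[of j] B F by (intro ennreal_leI) (simp add: integral_diff)
    finally show "(\<integral>\<^sup>+w. ennreal (B w - F j w) \<partial>M) \<le> ennreal (integral\<^sup>L M B - c)" .
  qed
  also have "\<dots> = ennreal (integral\<^sup>L M B - c)" by (simp add: Liminf_const)
  finally have bd: "(\<integral>\<^sup>+w. ennreal (B w - f w) \<partial>M) \<le> ennreal (integral\<^sup>L M B - c)" .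
  then have int: "integrable M (\<lambda>w. B w - f w)"
    using fB by (intro integrableI_nonneg) (auto intro: le_less_trans)
  have "integral\<^sup>L M (\<lambda>w. B w - f w) \<le> integral\<^sup>L M B - c"
    by (rule integral_real_bounded[OF c bd])
  moreover have "integrable M (\<lambda>w. B w - (B w - f w))" by (intro Bochner_Integration.integrable_diff B int)
  ultimately show ?thesis
    using Bochner_Integration.integral_diff[OF B int] by simp
qed

lemma conj_vec_eq_matrix: "conj_vec Q d w = (Q ** diag_matrix d) *v w"
  by (simp add: conj_vec_def matrix_vector_mul_assoc[symmetric] diag_matrix_mult_vec)

lemma conj_vec_bound:
  obtains a where "a \<ge> 1" "\<And>w. norm (conj_vec Q d w) \<le> a * norm w"
proof -
  obtain B where B: "\<And>w. norm ((Q ** diag_matrix d) *v w) \<le> B * norm w"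
    using linear_bounded[OF matrix_vector_mul_linear] by blast
  have "norm (conj_vec Q d w) \<le> max 1 B * norm w" for w
    unfolding conj_vec_eq_matrix by (rule order_trans[OF B]) (intro mult_right_mono, auto)
  then show thesis using that[of "max 1 B"] by simp
qed

lemma frac_int_measurable [measurable]:
  assumes [measurable]: "v \<in> borel_measurable borel" "T \<in> borel_measurable borel"
  shows "frac_int s v x T \<in> borel_measurable borel"
  unfolding frac_int_def[abs_def] second_diff_def by measurable

text \<open>Since \<open>a \<ge> 1\<close>, the single factor \<open>a\<^sup>2\<close> serves both
  branches of the minimum.\<close>

lemma frac_int_upper:
  fixes v :: "real^'n \<Rightarrow> real"
  assumes K: "K \<ge> 0" "second_diff v x (T w) \<le> K * min ((norm (T w))\<^sup>2) (norm (T w))"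
    and a: "a \<ge> 1" "norm (T w) \<le> a * norm w"
  shows "frac_int s v x T w \<le> K * a\<^sup>2 * frac_bound s w"
proof -
  have a2: "a \<le> a\<^sup>2" using a(1) by (simp add: self_le_power)
  have "(norm (T w))\<^sup>2 \<le> a\<^sup>2 * (norm w)\<^sup>2"
    using power_mono[OF a(2), of 2] by (simp add: power_mult_distrib)
  moreover have "norm (T w) \<le> a\<^sup>2 * norm w"
    using a(2) mult_right_mono[OF a2, of "norm w"] by simp
  ultimately have "min ((norm (T w))\<^sup>2) (norm (T w)) \<le> a\<^sup>2 * min ((norm w)\<^sup>2) (norm w)"
    using a by (simp add: min_mult_distrib_left min.coboundedI1 min.coboundedI2)
  then have "second_diff v x (T w) \<le> K * (a\<^sup>2 * min ((norm w)\<^sup>2) (norm w))"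
    using K by (meson mult_left_mono order_trans)
  then have "frac_int s v x T w \<le> K * (a\<^sup>2 * min ((norm w)\<^sup>2) (norm w)) / norm w powr (real CARD('n) + 2 * s)"
    unfolding frac_int_def by (intro divide_right_mono) auto
  then show ?thesis by (simp add: frac_bound_def)
qed

context
  fixes s \<eta>\<^sub>0 C L :: real and u :: "real^'n \<Rightarrow> real" and \<Omega> :: "(real^'n) set"
  assumes s: "1/2 < s" "s < 1"
    and lip: "L-lipschitz_on UNIV u" and sc: "semiconcave C u"
begin

text \<open>The test functions are quadratic above a supergradient on balls that shrink to the point; the
  second differences converge to those of \<open>u\<close> from below a fixed integrable bound.\<close>

lemma viscosity_ge_pointwise:
  fixes M :: "real^'n^'n"
  assumes \<Omega>: "open \<Omega>" "x \<in> \<Omega>"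
    and visc: "viscosity_ge (\<lambda>v x. ereal (1 - s) * frac_hess2 s v x) \<Omega> u (\<lambda>_. \<eta>\<^sub>0)"
    and M: "M \<in> coeffs2" "M = conj_diag Q m" and Q: "orthogonal_matrix Q" and m: "\<And>i. m $ i > 0"
  defines "T \<equiv> conj_vec Q (\<chi> i. sqrt (m $ i))"
  shows "integrable lborel (frac_int s u x T) \<and> 2 * \<eta>\<^sub>0 / (1 - s) \<le> integral\<^sup>L lborel (frac_int s u x T)"
proof -
  have L: "L \<ge> 0" using lip by (rule lipschitz_on_nonneg)
  have C: "C \<ge> 0" using sc by (simp add: semiconcave_def)
  have "continuous_on UNIV u" using sc by (simp add: semiconcave_def)
  then have um [measurable]: "u \<in> borel_measurable borel"
    by (rule borel_measurable_continuous_onI)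
  have Tm [measurable]: "T \<in> borel_measurable borel" by (simp add: T_def)
  obtain r1 where r1: "r1 > 0" "ball x r1 \<subseteq> \<Omega>" using \<Omega> open_contains_ball by blast
  \<comment> \<open>The cap \<open>r1\<close> keeps the balls inside the domain. The cap 1 makes the
    quadratic branch the smaller one on them.\<close>
  define r where "r = (\<lambda>j::nat. min 1 r1 / (real j + 1))"
  have r: "0 < r j" "r j \<le> 1" "r j \<le> r1" for j
  proof -
    have "min 1 r1 / (real j + 1) \<le> min 1 r1 / 1" using r1 by (intro divide_left_mono) auto
    then show "0 < r j" "r j \<le> 1" "r j \<le> r1" using r1 by (auto simp: r_def)
  qed
  have rlim: "r \<longlonglongrightarrow> 0"
  proof -
    have "r = (\<lambda>j. min 1 r1 * inverse (real (Suc j)))"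
      by (simp add: r_def divide_inverse add.commute fun_eq_iff)
    then show ?thesis by (simp only: tendsto_mult_right_zero[OF LIMSEQ_inverse_real_of_nat])
  qed
  obtain p where p: "\<And>y. u y \<le> u x + p \<bullet> (y - x) + C / 2 * (norm (y - x))\<^sup>2"
    using semiconcave_supergradient[OF sc] by blast
  \<comment> \<open>The summand 1 added to \<open>C / 2\<close> makes the contact with
    \<open>u\<close> at \<open>x\<close> strict, as the viscosity definition demands.\<close>
  define \<psi> where "\<psi> = (\<lambda>y. u x + p \<bullet> (y - x) + (C / 2 + 1) * ((y - x) \<bullet> (y - x)))"
  define v where "v = (\<lambda>j y. if y \<in> ball x (r j) then \<psi> y else u y)"
  have c2: "C2_closure N \<psi>" for N
    unfolding C2_closure_def
  proof (intro exI conjI ballI)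
    show "continuous_on (closure N) \<psi>" unfolding \<psi>_def by (intro continuous_intros)
    show "continuous_on (closure N) (\<lambda>y. p + (C + 2) *\<^sub>R (y - x))" by (intro continuous_intros)
    show "continuous_on (closure N) (\<lambda>y. (C + 2) *\<^sub>R mat 1 :: real^'n^'n)" by (intro continuous_intros)
    fix y
    show "(\<psi> has_derivative (\<lambda>h. (p + (C + 2) *\<^sub>R (y - x)) \<bullet> h)) (at y)"
      unfolding \<psi>_def
      by (auto intro!: derivative_eq_intros ext simp: inner_add_left inner_diff_left inner_commute algebra_simps)
    show "((\<lambda>y. p + (C + 2) *\<^sub>R (y - x)) has_derivative (\<lambda>h. ((C + 2) *\<^sub>R mat 1) *v h)) (at y)"
      by (auto intro!: derivative_eq_intros ext simp: scaleR_matrix_vector_assoc[symmetric])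
  qed
  have vd: "second_diff (v j) x y = (if norm y < r j then (C + 2) * (norm y)\<^sup>2 else second_diff u x y)" for j y
  proof -
    have "x \<in> ball x (r j)" using r by simp
    moreover have "\<psi> x = u x" by (simp add: \<psi>_def)
    moreover have "x + y \<in> ball x (r j) \<longleftrightarrow> norm y < r j" "x - y \<in> ball x (r j) \<longleftrightarrow> norm y < r j"
      by (simp_all add: dist_norm)
    moreover have "\<psi> (x + y) + \<psi> (x - y) - 2 * u x = (C + 2) * (norm y)\<^sup>2"
    proof -
      have "x + y - x = y" "x - y - x = - y" by simp_all
      then show ?thesis unfolding \<psi>_def power2_norm_eq_inner by (simp only:) (simp add: field_simps)
    qed
    ultimately show ?thesis by (simp add: second_diff_def v_def del: mem_ball)
  qed
  define K where "K = C + 2 + 2 * L"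
  have K: "K \<ge> 0" using C L by (simp add: K_def)
  have vK: "second_diff (v j) x y \<le> K * min ((norm y)\<^sup>2) (norm y)" for j y
  proof (cases "norm y < r j")
    case True
    then have "norm y \<le> 1" using r[of j] by linarith
    then have "(norm y)\<^sup>2 \<le> norm y" by (simp add: power2_eq_square mult_left_le)
    moreover have "(C + 2) * (norm y)\<^sup>2 \<le> K * (norm y)\<^sup>2" using L by (intro mult_right_mono) (auto simp: K_def)
    ultimately show ?thesis using True by (simp add: vd min_def)
  next
    case False
    have "(C + 2 * L) * min ((norm y)\<^sup>2) (norm y) \<le> K * min ((norm y)\<^sup>2) (norm y)"
      by (intro mult_right_mono) (auto simp: K_def)
    with False second_diff_upper[OF lip sc, of x y] show ?thesis by (simp add: vd)
  qed
  obtain a where a: "a \<ge> 1" "\<And>w. norm (T w) \<le> a * norm w"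
    unfolding T_def using conj_vec_bound[of Q "\<chi> i. sqrt (m $ i)"] by blast
  define B where "B = (\<lambda>w. K * a\<^sup>2 * frac_bound s (w :: real^'n))"
  have B: "integrable lborel B"
    unfolding B_def by (intro integrable_mult_right integrable_frac_bound s)
  have vm [measurable]: "v j \<in> borel_measurable borel" for j
  proof -
    have "continuous_on UNIV \<psi>" unfolding \<psi>_def by (intro continuous_intros)
    then have [measurable]: "\<psi> \<in> borel_measurable borel" by (rule borel_measurable_continuous_onI)
    show ?thesis unfolding v_def by (rule measurable_If_set) auto
  qed
  have FB: "frac_int s (v j) x T w \<le> B w" for j w
    unfolding B_def by (rule frac_int_upper[OF K vK a])
  have ext: "ereal (2 * \<eta>\<^sub>0 / (1 - s)) \<le> ext_integral (frac_int s (v j) x T)" for j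
  proof -
    have "ereal \<eta>\<^sub>0 \<le> ereal (1 - s) * frac_hess2 s (v j) x"
    proof -
      have "\<psi> y > u y" if "y \<noteq> x" for y
      proof -
        have "(y - x) \<bullet> (y - x) > 0" using that by simp
        then show ?thesis using p[of y] by (simp add: \<psi>_def power2_norm_eq_inner algebra_simps)
      qed
      moreover have "\<psi> x = u x" by (simp add: \<psi>_def)
      moreover have "ball x (r j) \<subseteq> \<Omega>" using r[of j] r1 by (meson subset_ball subset_trans)
      ultimately show ?thesis
        using visc[unfolded viscosity_ge_def, rule_format, OF \<Omega>(2), of "ball x (r j)" \<psi>] r[of j] c2
        unfolding v_def by simp
    qed
    also have "\<dots> \<le> ereal (1 - s) * frac_linear s M (v j) x"
      using s M(1) by (intro ereal_mult_left_mono) (auto simp: frac_hess2_def intro: INF_lower)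
    also have "frac_linear s M (v j) x = ereal (1/2) * ext_integral (frac_int s (v j) x T)"
      unfolding M(2) T_def by (rule frac_linear_conj_diag[OF Q m]) simp
    finally have *: "ereal \<eta>\<^sub>0 \<le> ereal (1 - s) * (ereal (1/2) * ext_integral (frac_int s (v j) x T))" .
    show ?thesis
    proof (cases "ext_integral (frac_int s (v j) x T)")
      case (real c)
      with * s show ?thesis by (simp add: field_simps)
    qed (use * s in auto)
  qed
  have int: "integrable lborel (frac_int s (v j) x T)" for j
    by (rule integrable_of_ext_integral[OF _ B FB ext]) simp
  have ge: "2 * \<eta>\<^sub>0 / (1 - s) \<le> integral\<^sup>L lborel (frac_int s (v j) x T)" for j
    using ext[of j] by (simp add: ext_integral_eq_integral[OF int])
  \<comment> \<open>For fixed \<open>w\<close> the sequence is eventually constant: once the ball no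
    longer contains \<open>x + T w\<close>, the second difference is that of \<open>u\<close>. If
    \<open>T w = 0\<close>, both sides vanish.\<close>
  have lim: "(\<lambda>j. frac_int s (v j) x T w) \<longlonglongrightarrow> frac_int s u x T w" for w
  proof (rule tendsto_eventually)
    show "\<forall>\<^sub>F j in sequentially. frac_int s (v j) x T w = frac_int s u x T w"
    proof (cases "T w = 0")
      case True
      then show ?thesis using r by (simp add: frac_int_def vd second_diff_def)
    next
      case False
      then have "\<forall>\<^sub>F j in sequentially. r j < norm (T w)"
        by (intro order_tendstoD(2)[OF rlim]) simp
      then show ?thesis
        by (rule eventually_mono) (simp add: frac_int_def vd)
    qed
  qed
  show ?thesis
    by (rule Fatou_upper[OF int B _ FB lim ge]) simp
qed

section \<open>Dependence of the integral on the eigenvalues\<close>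

text \<open>Scaling \<open>d\<close> is absorbed into \<open>w\<close>. The kernel contributes the
  power n + 2 s of \<open>c\<close> and the Jacobian removes n of it.\<close>

lemma integral_frac_int_scale:
  fixes c :: real
  assumes c: "c > 0" and int: "integrable lborel (frac_int s u x (conj_vec Q (c *\<^sub>R d)))"
  shows "integrable lborel (frac_int s u x (conj_vec Q d))"
    and "integral\<^sup>L lborel (frac_int s u x (conj_vec Q (c *\<^sub>R d))) =
      c powr (2 * s) * integral\<^sup>L lborel (frac_int s u x (conj_vec Q d))"
proof -
  let ?f = "frac_int s u x (conj_vec Q d)" and ?g = "frac_int s u x (conj_vec Q (c *\<^sub>R d))"
  have "continuous_on UNIV u" using sc by (simp add: semiconcave_def)
  then have um [measurable]: "u \<in> borel_measurable borel"
    by (rule borel_measurable_continuous_onI)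
  define n where "n = CARD('n)"
  have lb: "lborel = density (distr lborel borel (\<lambda>w::real^'n. c *\<^sub>R w)) (\<lambda>_. ennreal (c ^ n))"
    using lborel_affine[of c "0 :: real^'n"] c by (simp add: n_def)
  have gf: "?g w = c powr (real n + 2 * s) * ?f (c *\<^sub>R w)" for w
  proof -
    have "conj_vec Q (c *\<^sub>R d) w = conj_vec Q d (c *\<^sub>R w)"
      by (simp add: conj_vec_def mult.assoc mult.left_commute)
    then show ?thesis using c by (simp add: frac_int_def powr_mult n_def)
  qed
  have cp: "c powr (real n + 2 * s) > 0" using c by simp
  have 1: "integrable lborel (\<lambda>w. ?f (c *\<^sub>R w))"
  proof -
    have "(\<lambda>w. ?f (c *\<^sub>R w)) = (\<lambda>w. inverse (c powr (real n + 2 * s)) * ?g w)"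
      using cp by (simp add: gf fun_eq_iff)
    then show ?thesis using int by simp
  qed
  then have "integrable lborel (\<lambda>w. c ^ n * ?f (c *\<^sub>R w))" by simp
  then have "integrable (density (distr lborel borel (\<lambda>w::real^'n. c *\<^sub>R w)) (\<lambda>_. ennreal (c ^ n))) ?f"
    using c by (subst integrable_density) (auto simp: integrable_distr_eq)
  then show "integrable lborel ?f" by (simp only: lb[symmetric])
  have "integral\<^sup>L lborel ?f =
      integral\<^sup>L (density (distr lborel borel (\<lambda>w::real^'n. c *\<^sub>R w)) (\<lambda>_. ennreal (c ^ n))) ?f"
    by (simp only: lb[symmetric])
  also have "\<dots> = c ^ n * integral\<^sup>L lborel (\<lambda>w. ?f (c *\<^sub>R w))"
    using c by (subst integral_density) (auto simp: integral_distr)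
  finally have 2: "integral\<^sup>L lborel ?f = c powr real n * integral\<^sup>L lborel (\<lambda>w. ?f (c *\<^sub>R w))"
    using c by (simp add: powr_realpow)
  have "?g = (\<lambda>w. c powr (real n + 2 * s) * ?f (c *\<^sub>R w))"
    using gf by (rule ext)
  then have "integral\<^sup>L lborel ?g = c powr (real n + 2 * s) * integral\<^sup>L lborel (\<lambda>w. ?f (c *\<^sub>R w))"
    by (simp only: integral_mult_right_zero)
  then show "integral\<^sup>L lborel ?g = c powr (2 * s) * integral\<^sup>L lborel ?f"
    by (simp add: 2 powr_add mult_ac)
qed

text \<open>Averaging over the reflection in the \<open>k\<close>-th coordinate turns the integrand into an even
  semi-concave function of that coordinate, which decreases up to the semi-concavity error.\<close>

lemma integral_frac_int_shrink:
  assumes Q: "orthogonal_matrix Q"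
    and ab: "\<And>i. i \<noteq> k \<Longrightarrow> a $ i = b $ i" "0 \<le> b $ k" "b $ k \<le> a $ k" "a $ k \<le> 1"
    and inta: "integrable lborel (frac_int s u x (conj_vec Q a))"
    and intb: "integrable lborel (frac_int s u x (conj_vec Q b))"
  shows "integral\<^sup>L lborel (frac_int s u x (conj_vec Q a)) \<le>
    integral\<^sup>L lborel (frac_int s u x (conj_vec Q b)) +
    (C + 2 * L) * a $ k * integral\<^sup>L lborel (frac_bound s :: real^'n \<Rightarrow> real)"
proof -
  have L: "L \<ge> 0" using lip by (rule lipschitz_on_nonneg)
  have C: "C \<ge> 0" using sc by (simp add: semiconcave_def)
  have "continuous_on UNIV u" using sc by (simp add: semiconcave_def)
  then have um [measurable]: "u \<in> borel_measurable borel"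
    by (rule borel_measurable_continuous_onI)
  define R where "R = (\<lambda>w::real^'n. \<chi> i. if i = k then - w $ i else w $ i)"
  have "linear R" unfolding R_def by (rule linearI) (auto simp: vec_eq_iff)
  moreover have "R v \<bullet> R w = v \<bullet> w" for v w
    unfolding R_def inner_vec_def by (rule sum.cong) auto
  ultimately have R: "orthogonal_transformation R" by (simp add: orthogonal_transformation_def)
  have [measurable]: "R \<in> borel_measurable borel"
    by (intro borel_measurable_continuous_onI linear_continuous_on linear_conv_bounded_linear[THEN iffD1] \<open>linear R\<close>)
  have nR: "norm (R w) = norm w" for w using R by (rule orthogonal_transformation_norm)
  have refl: "integrable lborel (\<lambda>w. f (R w)) \<and> integral\<^sup>L lborel (\<lambda>w. f (R w)) = integral\<^sup>L lborel f"
    if f: "integrable lborel f" for f :: "real^'n \<Rightarrow> real"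
  proof -
    have [measurable]: "f \<in> borel_measurable borel" using f by simp
    have "integrable (distr lborel borel R) f" by (simp add: distr_lborel_isometry[OF R] f)
    then have "integrable lborel (\<lambda>w. f (R w))" by (subst (asm) integrable_distr_eq) auto
    moreover have "integral\<^sup>L (distr lborel borel R) f = integral\<^sup>L lborel (\<lambda>w. f (R w))"
      by (rule integral_distr) auto
    ultimately show ?thesis by (simp add: distr_lborel_isometry[OF R])
  qed
  define q where "q = Q *v axis k 1"
  have q: "norm q = 1" by (simp add: q_def norm_orthogonal_matrix[OF Q])
  define y where "y = (\<lambda>w::real^'n. Q *v (\<chi> i. if i = k then 0 else a $ i * w $ i))"
  \<comment> \<open>The reflection only changes the sign of the component along \<open>q\<close>,
    the image of the \<open>k\<close>-th axis; the remainder \<open>y w\<close> is common to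
    \<open>a\<close> and \<open>b\<close>.\<close>
  have dec: "conj_vec Q d w = y w + (d $ k * w $ k) *\<^sub>R q" "conj_vec Q d (R w) = y w - (d $ k * w $ k) *\<^sub>R q"
    if "\<And>i. i \<noteq> k \<Longrightarrow> d $ i = a $ i" for d w
  proof -
    have "(\<chi> i. d $ i * w $ i) = (\<chi> i. if i = k then 0 else a $ i * w $ i) + (d $ k * w $ k) *\<^sub>R axis k 1"
      using that by (auto simp: vec_eq_iff axis_def)
    then show "conj_vec Q d w = y w + (d $ k * w $ k) *\<^sub>R q"
      unfolding conj_vec_def y_def q_def
      by (simp add: matrix_vector_right_distrib matrix_vector_mult_scaleR)
    have "(\<chi> i. d $ i * R w $ i) = (\<chi> i. if i = k then 0 else a $ i * w $ i) + (- (d $ k * w $ k)) *\<^sub>R axis k 1"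
      using that by (auto simp: vec_eq_iff axis_def R_def)
    then show "conj_vec Q d (R w) = y w - (d $ k * w $ k) *\<^sub>R q"
      unfolding conj_vec_def y_def q_def
      by (simp only: matrix_vector_right_distrib matrix_vector_mult_scaleR) simp
  qed
  let ?f = "\<lambda>d. frac_int s u x (conj_vec Q d)"
  \<comment> \<open>The four values in the two second differences form even parts about the base
    points \<open>x + y w\<close> and \<open>x - y w\<close>, and the estimate along
    \<open>q\<close> applies to each.\<close>
  have pt: "?f a w + ?f a (R w) \<le> ?f b w + ?f b (R w) + 2 * ((C + 2 * L) * a $ k * frac_bound s w)" for w
  proof -
    define \<epsilon> where "\<epsilon> = min ((a $ k * w $ k)\<^sup>2) \<bar>a $ k * w $ k\<bar>"
    let ?S = "\<lambda>d. second_diff u x (conj_vec Q d w) + second_diff u x (conj_vec Q d (R w))"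
    have S: "?S d = (u ((x + y w) + (d $ k * w $ k) *\<^sub>R q) + u ((x + y w) - (d $ k * w $ k) *\<^sub>R q)) +
        (u ((x - y w) + (d $ k * w $ k) *\<^sub>R q) + u ((x - y w) - (d $ k * w $ k) *\<^sub>R q)) - 4 * u x"
      if "\<And>i. i \<noteq> k \<Longrightarrow> d $ i = a $ i" for d
    proof -
      have e: "conj_vec Q d w = y w + (d $ k * w $ k) *\<^sub>R q"
        "conj_vec Q d (R w) = y w - (d $ k * w $ k) *\<^sub>R q"
        using dec that by blast+
      show ?thesis unfolding e second_diff_def by (simp add: algebra_simps)
    qed
    have "?S a \<le> ?S b + 2 * ((C + 2 * L) * \<epsilon>)"
      using even_part_decreasing[OF lip sc ab(2,3) q, of "x + y w" "w $ k"]
        even_part_decreasing[OF lip sc ab(2,3) q, of "x - y w" "w $ k"]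
      using ab(1) by (simp add: S \<epsilon>_def)
    \<comment> \<open>Because \<open>a $ k \<le> 1\<close>, its square is at most
      \<open>a $ k\<close>, so both branches carry a single factor \<open>a $ k\<close>. In the
      application this is the root of the raised eigenvalue.\<close>
    also have "\<epsilon> \<le> a $ k * min ((norm w)\<^sup>2) (norm w)"
    proof -
      have wk: "\<bar>w $ k\<bar> \<le> norm w" by (rule component_le_norm_cart)
      have a0: "0 \<le> a $ k" using ab by linarith
      have "(a $ k * w $ k)\<^sup>2 \<le> a $ k * (norm w)\<^sup>2"
      proof -
        have "(a $ k)\<^sup>2 \<le> a $ k" using ab(4) a0 by (simp add: power2_eq_square mult_left_le)
        moreover have "(w $ k)\<^sup>2 \<le> (norm w)\<^sup>2" using wk by (metis abs_le_square_iff abs_norm_cancel)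
        ultimately show ?thesis using a0 by (simp add: power_mult_distrib mult_mono)
      qed
      moreover have "\<bar>a $ k * w $ k\<bar> \<le> a $ k * norm w"
        using wk a0 by (simp add: abs_mult mult_left_mono)
      ultimately show ?thesis
        using a0 by (simp add: \<epsilon>_def min_mult_distrib_left min.coboundedI1 min.coboundedI2)
    qed
    finally have "?S a \<le> ?S b + 2 * ((C + 2 * L) * (a $ k * min ((norm w)\<^sup>2) (norm w)))"
      using C L by (simp add: mult_left_mono)
    then have "?S a / norm w powr (real CARD('n) + 2 * s) \<le>
        (?S b + 2 * ((C + 2 * L) * (a $ k * min ((norm w)\<^sup>2) (norm w)))) / norm w powr (real CARD('n) + 2 * s)"
      by (intro divide_right_mono) auto
    then show ?thesis
      by (simp add: frac_int_def nR frac_bound_def add_divide_distrib mult.assoc)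
  qed
  have intg: "integrable lborel (\<lambda>w::real^'n. 2 * ((C + 2 * L) * a $ k * frac_bound s w))"
    by (intro integrable_mult_right integrable_frac_bound s)
  have "integral\<^sup>L lborel (\<lambda>w. ?f a w + ?f a (R w)) \<le>
      integral\<^sup>L lborel (\<lambda>w. ?f b w + ?f b (R w) + 2 * ((C + 2 * L) * a $ k * frac_bound s w))"
    by (rule integral_mono) (use pt intg inta intb refl in auto)
  then show ?thesis
    using refl[OF inta] refl[OF intb] inta intb intg integrable_frac_bound[OF s, where 'a="real^'n"]
    by simp
qed

end

section \<open>Degenerate coefficient matrices\<close>

text \<open>A degenerate coefficient matrix with eigenvalues \<open>m\<close> is scaled by \<open>c = T / \<tau>\<close> so that the
  large eigenvalues have the fixed sum \<open>T\<close>; then its small eigenvalue can be raised to some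
  \<open>\<epsilon> \<le> (n - 1) / T\<close> such that the result is again a coefficient matrix.\<close>

lemma raise_small_eigenvalue:
  fixes m :: "real^'n"
  assumes n: "CARD('n) \<ge> 2" and m: "\<And>i. m $ i > 0"
    and cone: "(\<Sum>i\<in>UNIV. m $ i)\<^sup>2 / (real CARD('n) - 1) - (\<Sum>i\<in>UNIV. (m $ i)\<^sup>2) = 1/2"
    and T: "T \<ge> real CARD('n)" and small: "m $ k \<le> 1 / (4 * T)"
  defines "\<tau> \<equiv> (\<Sum>i\<in>UNIV - {k}. m $ i)"
  obtains \<epsilon> where "\<tau> \<ge> (real CARD('n) - 1) / (4 * m $ k)" "T / \<tau> * m $ k \<le> \<epsilon>"
    "\<epsilon> \<le> (real CARD('n) - 1) / T" "orthogonal_matrix Q \<Longrightarrow>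
      conj_diag Q (\<chi> i. if i = k then \<epsilon> else T / \<tau> * m $ i) \<in> coeffs2"
proof -
  define n where "n = real CARD('n)"
  have n2: "n \<ge> 2" using n by (simp add: n_def)
  have Tn: "T \<ge> n" using T by (simp add: n_def)
  have T0: "T > 0" using Tn n2 by linarith
  define e where "e = m $ k"
  define q where "q = (\<Sum>i\<in>UNIV - {k}. (m $ i)\<^sup>2)"
  \<comment> \<open>The sum of squared deviations of the other n - 1 eigenvalues from their mean;
    Cauchy-Schwarz says that it is nonnegative.\<close>
  define D where "D = q - \<tau>\<^sup>2 / (n - 1)"
  have e: "e > 0" using m by (simp add: e_def)
  have "\<tau>\<^sup>2 \<le> (n - 1) * q"
    using sum_squared_le_sum_of_squares[of "\<lambda>i. m $ i" "UNIV - {k}"]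
    by (simp add: \<tau>_def q_def n_def card_Diff_singleton of_nat_diff mult.commute)
  then have D: "D \<ge> 0" using n2 by (simp add: D_def field_simps)
  have quad: "(a + t)\<^sup>2 / (n - 1) - a\<^sup>2 = 2 * a * t / (n - 1) - (n - 2) / (n - 1) * a\<^sup>2 + t\<^sup>2 / (n - 1)" for a t
  proof -
    have f: "(n - 2) / (n - 1) = 1 - 1 / (n - 1)" using n2 by (simp add: field_simps)
    show ?thesis unfolding f by (simp add: power2_sum add_divide_distrib algebra_simps)
  qed
  have s1: "(\<Sum>i\<in>UNIV. m $ i) = e + \<tau>" and s2: "(\<Sum>i\<in>UNIV. (m $ i)\<^sup>2) = e\<^sup>2 + q"
    by (simp_all add: \<tau>_def q_def e_def sum.remove[of UNIV k])
  have "(e + \<tau>)\<^sup>2 / (n - 1) - (e\<^sup>2 + q) = 1/2"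
    using cone by (simp only: s1 s2 n_def)
  then have eqD: "2 * e * \<tau> / (n - 1) - (n - 2) / (n - 1) * e\<^sup>2 - D = 1/2"
    using quad[of e \<tau>] unfolding D_def by linarith
  have "0 \<le> (n - 2) / (n - 1) * e\<^sup>2" using n2 by simp
  \<comment> \<open>The constraint therefore makes e \<tau> bounded below and also bounds the spread
    \<open>D\<close> by a multiple of e \<tau>: a small eigenvalue forces a large sum of the
    others.\<close>
  then have big: "2 * e * \<tau> / (n - 1) \<ge> 1/2 + D" using eqD by linarith
  then have "2 * e * \<tau> / (n - 1) \<ge> 1/2" using D by linarith
  then have et: "4 * e * \<tau> \<ge> n - 1" using n2 by (simp add: field_simps)
  then have \<tau>big: "\<tau> \<ge> (n - 1) / (4 * e)" using e by (simp add: field_simps)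
  have \<tau>0: "\<tau> > 0" using \<tau>big e n2 by (smt (verit) divide_pos_pos)
  define c where "c = T / \<tau>"
  have c: "c > 0" "c * \<tau> = T" using T0 \<tau>0 by (auto simp: c_def)
  \<comment> \<open>Combines e T <= 1/4 with 4 e \<tau> >= n - 1. It bounds the scaled spread
    \<open>c\<^sup>2 * D\<close> and later keeps the scaled small eigenvalue \<open>c * e\<close>
    below the new one.\<close>
  have ratio: "e * T\<^sup>2 \<le> \<tau> * ((n - 1) / 4)"
  proof -
    have "e * T \<le> 1/4" using small T0 by (simp add: e_def field_simps)
    then have "(e * T)\<^sup>2 \<le> (1/4)\<^sup>2" using e T0 by (intro power_mono) auto
    then have "4 * e * (e * T\<^sup>2) \<le> 1/4" by (simp add: power2_eq_square algebra_simps)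
    also have "1/4 \<le> (n - 1) * ((n - 1) / 4)"
    proof -
      have "1 * 1 \<le> (n - 1) * (n - 1)" using n2 by (intro mult_mono) auto
      then show ?thesis by simp
    qed
    also have "\<dots> \<le> 4 * e * \<tau> * ((n - 1) / 4)" using et n2 by (intro mult_right_mono) auto
    finally have "(4 * e) * (e * T\<^sup>2) \<le> (4 * e) * (\<tau> * ((n - 1) / 4))" by (simp add: mult.assoc)
    then show ?thesis using e by (simp only: mult_le_cancel_left_pos)
  qed
  have cD: "c\<^sup>2 * D \<le> 1/2"
  proof -
    have "D \<le> 2 * e * \<tau> / (n - 1)" using big by linarith
    then have "c\<^sup>2 * D \<le> c\<^sup>2 * (2 * e * \<tau> / (n - 1))" by (intro mult_left_mono) auto
    also have "\<dots> = (2 / ((n - 1) * \<tau>)) * (e * T\<^sup>2)"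
      using \<tau>0 n2 by (simp add: c_def power2_eq_square field_simps)
    also have "\<dots> \<le> (2 / ((n - 1) * \<tau>)) * (\<tau> * ((n - 1) / 4))"
      using ratio \<tau>0 n2 by (intro mult_left_mono) auto
    also have "\<dots> = 1/2" using \<tau>0 n2 by simp
    finally show ?thesis .
  qed
  \<comment> \<open>By \<open>quad\<close>, for \<open>a \<ge> 0\<close> the scaled vector with
    small eigenvalue replaced by \<open>a\<close> gives a coefficient matrix exactly when
    \<open>g a = 1/2 + c\<^sup>2 * D\<close>. The intermediate value theorem applies:
    \<open>g\<close> is 0 at 0 and at least 1 at \<open>(n - 1) / T\<close>.\<close>
  define g where "g = (\<lambda>a. 2 * a * T / (n - 1) - (n - 2) / (n - 1) * a\<^sup>2)"
  have "\<exists>a. 0 \<le> a \<and> a \<le> (n - 1) / T \<and> g a = 1/2 + c\<^sup>2 * D"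
  proof (rule IVT')
    show "g 0 \<le> 1/2 + c\<^sup>2 * D" using D by (simp add: g_def)
    have "g ((n - 1) / T) = 2 - (n - 1) * (n - 2) / T\<^sup>2"
    proof -
      have "2 * ((n - 1) / T) * T / (n - 1) = 2" using T0 n2 by (simp add: divide_eq_eq)
      moreover have "(n - 2) / (n - 1) * ((n - 1) / T)\<^sup>2 = (n - 1) * (n - 2) / T\<^sup>2"
        using n2 by (simp add: power2_eq_square)
      ultimately show ?thesis by (simp only: g_def)
    qed
    moreover have "(n - 1) * (n - 2) \<le> T * T" using Tn n2 by (intro mult_mono) auto
    then have "(n - 1) * (n - 2) / T\<^sup>2 \<le> 1" using T0 by (simp add: power2_eq_square)
    ultimately show "1/2 + c\<^sup>2 * D \<le> g ((n - 1) / T)" using cD by linarith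
    show "0 \<le> (n - 1) / T" using T0 n2 by simp
    show "continuous_on {0..(n - 1) / T} g" unfolding g_def by (intro continuous_intros) (use n2 in auto)
  qed
  then obtain a where a: "0 \<le> a" "a \<le> (n - 1) / T" "g a = 1/2 + c\<^sup>2 * D" by blast
  have "0 \<le> (n - 2) / (n - 1) * a\<^sup>2" using n2 by simp
  moreover have "0 \<le> c\<^sup>2 * D" using D by simp
  ultimately have "2 * a * T / (n - 1) \<ge> 1/2" using a(3) unfolding g_def by linarith
  then have aT: "4 * a * T \<ge> n - 1" using n2 by (simp add: field_simps)
  have ca: "c * e \<le> a"
  proof -
    have "c * e * (4 * T) = 4 / \<tau> * (e * T\<^sup>2)" by (simp add: c_def power2_eq_square)
    also have "\<dots> \<le> 4 / \<tau> * (\<tau> * ((n - 1) / 4))" using ratio \<tau>0 by (intro mult_left_mono) auto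
    also have "\<dots> = n - 1" using \<tau>0 by simp
    also have "\<dots> \<le> a * (4 * T)" using aT by simp
    finally show ?thesis using T0 by simp
  qed
  have mem: "conj_diag Q (\<chi> i. if i = k then a else T / \<tau> * m $ i) \<in> coeffs2"
    if Q: "orthogonal_matrix Q"
  proof -
    let ?m = "\<chi> i. if i = k then a else T / \<tau> * m $ i"
    have "(\<Sum>i\<in>UNIV. ?m $ i) = a + (\<Sum>i\<in>UNIV - {k}. c * m $ i)"
      by (simp add: sum.remove[of UNIV k] c_def)
    also have "\<dots> = a + T" by (simp add: sum_distrib_left[symmetric] \<tau>_def[symmetric] c)
    finally have t1: "(\<Sum>i\<in>UNIV. ?m $ i) = a + T" .
    have "(\<Sum>i\<in>UNIV. (?m $ i)\<^sup>2) = a\<^sup>2 + (\<Sum>i\<in>UNIV - {k}. c\<^sup>2 * (m $ i)\<^sup>2)"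
      by (simp add: sum.remove[of UNIV k] c_def power_mult_distrib power_divide)
    also have "\<dots> = a\<^sup>2 + c\<^sup>2 * q" by (simp add: sum_distrib_left[symmetric] q_def)
    finally have t2: "(\<Sum>i\<in>UNIV. (?m $ i)\<^sup>2) = a\<^sup>2 + c\<^sup>2 * q" .
    have "T\<^sup>2 = c\<^sup>2 * \<tau>\<^sup>2" using c by (metis power_mult_distrib)
    then have "c\<^sup>2 * q = c\<^sup>2 * D + T\<^sup>2 / (n - 1)" by (simp add: D_def algebra_simps)
    then have "(a + T)\<^sup>2 / (n - 1) - (a\<^sup>2 + c\<^sup>2 * q) = 1/2"
      using quad[of a T] a(3) unfolding g_def by linarith
    moreover have "a + T > 0" using a T0 by linarith
    ultimately show ?thesis
      unfolding conj_diag_coeffs2_iff[OF n Q] t1 t2 by (simp add: n_def)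
  qed
  show thesis
    by (rule that[of a]) (use \<tau>big ca a mem in \<open>simp_all add: n_def e_def c_def\<close>)
qed

text \<open>For a multiple \<kappa> of the identity the constraint reads n \<kappa>^2 / (n - 1) =
  1/2. This matrix is the competitor that beats the degenerate ones.\<close>

lemma coeffs2_isotropic:
  assumes n: "CARD('n::finite) \<ge> 2"
  obtains \<kappa> where "0 < \<kappa>" "\<kappa> \<le> 1" "conj_diag (mat 1) (\<chi> i::'n. \<kappa>) \<in> coeffs2"
proof -
  define n where "n = real CARD('n)"
  have n2: "n \<ge> 2" using n by (simp add: n_def)
  define \<kappa> where "\<kappa> = sqrt ((n - 1) / (2 * n))"
  have k2: "\<kappa>\<^sup>2 = (n - 1) / (2 * n)" using n2 by (simp add: \<kappa>_def)
  have k: "0 < \<kappa>" "\<kappa> \<le> 1" using n2 by (auto simp: \<kappa>_def)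
  have "(n * \<kappa>)\<^sup>2 / (n - 1) - n * \<kappa>\<^sup>2 = 1/2"
  proof -
    have nk: "n * \<kappa>\<^sup>2 = (n - 1) / 2" using n2 by (simp add: k2)
    have "(n * \<kappa>)\<^sup>2 = n * (n * \<kappa>\<^sup>2)" by (simp add: power2_eq_square)
    then have "(n * \<kappa>)\<^sup>2 = (n / 2) * (n - 1)" unfolding nk by simp
    then have "(n * \<kappa>)\<^sup>2 / (n - 1) = n / 2" using n2 by simp
    then show ?thesis unfolding nk by (simp add: diff_divide_distrib)
  qed
  then have "conj_diag (mat 1) (\<chi> i::'n. \<kappa>) \<in> coeffs2"
    using k n2 by (simp add: conj_diag_coeffs2_iff[OF n orthogonal_matrix_id] n_def)
  with k that show thesis by blast
qed

section \<open>Choice of the threshold and comparison of the two infima\<close>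

theorem theorem1p4:
  fixes s \<eta>\<^sub>0 L SC :: real
  assumes "CARD('n::finite) \<ge> 2" and "1/2 < s" and "s < 1" and "\<eta>\<^sub>0 > 0"
  shows "\<exists>\<theta>>0. \<forall>(\<Omega> :: (real^'n) set) (u :: real^'n \<Rightarrow> real).
    open \<Omega> \<and> L-lipschitz_on UNIV u \<and> semiconcave SC u \<and>
    viscosity_ge (\<lambda>v x. ereal (1 - s) * frac_hess2 s v x) \<Omega> u (\<lambda>_. \<eta>\<^sub>0)
    \<longrightarrow> (\<forall>x\<in>\<Omega>. frac_hess2 s u x = frac_hess2_trunc s \<theta> u x)"
proof (cases "L \<ge> 0 \<and> SC \<ge> 0")
  \<comment> \<open>For a negative constant no function satisfies the hypotheses, so any positive
    threshold will do.\<close>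
  case False
  then show ?thesis
    by (intro exI[of _ 1]) (auto simp: semiconcave_def dest: lipschitz_on_nonneg)
next
  case True
  then have L: "L \<ge> 0" and SC: "SC \<ge> 0" by auto
  note n = assms(1) and s = assms(2,3)
  define N where "N = real CARD('n)"
  have N2: "N \<ge> 2" using n by (simp add: N_def)
  \<comment> \<open>Two roles: it bounds the integral for the isotropic matrix from above, and
    \<open>P * sqrt \<epsilon>\<close> is the error made by raising an eigenvalue to
    \<epsilon>.\<close>
  define P where "P = (SC + 2 * L) * integral\<^sup>L lborel (frac_bound s :: real^'n \<Rightarrow> real)"
  have P: "P \<ge> 0"
    using L SC by (auto simp: P_def frac_bound_nonneg intro!: mult_nonneg_nonneg Bochner_Integration.integral_nonneg)
  define \<eta> where "\<eta> = 2 * \<eta>\<^sub>0 / (1 - s)"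
  have \<eta>: "\<eta> > 0" using s assms(4) by (simp add: \<eta>_def)
  \<comment> \<open>Chosen so that the error for \<epsilon> <= (N - 1) / T is at most half of the
    viscosity bound \<eta>.\<close>
  define T where "T = N * (1 + (2 * P / \<eta>)\<^sup>2)"
  have "(2 * P / \<eta>)\<^sup>2 \<ge> 0" by simp
  then have TN: "T \<ge> N" using N2 by (simp add: T_def)
  then have T0: "T > 0" using N2 by linarith
  have PT: "P * sqrt ((N - 1) / T) \<le> \<eta> / 2"
  proof (rule power2_le_imp_le)
    have "(P * sqrt ((N - 1) / T))\<^sup>2 = P\<^sup>2 * ((N - 1) / T)"
      using N2 T0 by (simp add: power_mult_distrib)
    also have "\<dots> \<le> P\<^sup>2 * (N / T)" using T0 by (intro mult_left_mono divide_right_mono) auto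
    also have "\<dots> = P\<^sup>2 / (1 + (2 * P / \<eta>)\<^sup>2)" using N2 by (simp add: T_def)
    also have "\<dots> \<le> (\<eta> / 2)\<^sup>2"
    proof -
      have "1 + (2 * P / \<eta>)\<^sup>2 > 0" by (simp add: add_pos_nonneg)
      moreover have "P\<^sup>2 \<le> (\<eta> / 2)\<^sup>2 * (1 + (2 * P / \<eta>)\<^sup>2)"
      proof -
        have "(\<eta> / 2)\<^sup>2 * (2 * P / \<eta>)\<^sup>2 = P\<^sup>2" using \<eta> by (simp add: power_mult_distrib[symmetric])
        then show ?thesis by (simp add: distrib_left)
      qed
      ultimately show ?thesis by (simp add: divide_le_eq)
    qed
    finally show "(P * sqrt ((N - 1) / T))\<^sup>2 \<le> (\<eta> / 2)\<^sup>2" .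
  qed (use \<eta> in simp)
  \<comment> \<open>The scaling factor \<tau> / T, raised to the power s, has to lift \<eta> / 2 to
    at least \<open>P\<close>; \<open>A\<close> is the smallest value for which it does.\<close>
  define A where "A = (2 * P / \<eta>) powr (1 / s)"
  have A: "A \<ge> 0" by (simp add: A_def)
  obtain \<kappa> where \<kappa>: "0 < \<kappa>" "\<kappa> \<le> 1" "conj_diag (mat 1) (\<chi> i::'n. \<kappa>) \<in> coeffs2"
    using coeffs2_isotropic[OF n] by blast
  \<comment> \<open>The bound by \<kappa> keeps the isotropic matrix admissible. The other one gives
    both the smallness needed to raise the eigenvalue and \<tau> >= T A. Only n, s, \<eta>0, L and
    SC enter.\<close>
  define \<theta> where "\<theta> = min \<kappa> (1 / (4 * T * (A + 1)))"
  have \<theta>: "\<theta> > 0" "\<theta> \<le> \<kappa>" "\<theta> \<le> 1 / (4 * T)" "T * A \<le> 1 / (4 * \<theta>)"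
  proof -
    show pos: "\<theta> > 0" "\<theta> \<le> \<kappa>" using \<kappa> T0 A by (auto simp: \<theta>_def)
    have le: "\<theta> \<le> 1 / (4 * T * (A + 1))" by (simp add: \<theta>_def)
    also have "\<dots> \<le> 1 / (4 * T)" using T0 A by (intro divide_left_mono) (auto intro!: mult_pos_pos add_nonneg_pos)
    finally show "\<theta> \<le> 1 / (4 * T)" .
    have "T * A * (4 * \<theta>) \<le> 4 * T * (A + 1) * \<theta>" using T0 pos by (simp add: algebra_simps)
    also have "\<dots> \<le> 1" using le T0 A by (simp add: pos_le_divide_eq mult.commute)
    finally show "T * A \<le> 1 / (4 * \<theta>)" using pos by (simp add: pos_le_divide_eq)
  qed
  show ?thesis
  proof (intro exI[of _ \<theta>] conjI allI impI ballI \<theta>(1))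
    fix \<Omega> :: "(real^'n) set" and u :: "real^'n \<Rightarrow> real" and x
    assume "open \<Omega> \<and> L-lipschitz_on UNIV u \<and> semiconcave SC u \<and>
      viscosity_ge (\<lambda>v x. ereal (1 - s) * frac_hess2 s v x) \<Omega> u (\<lambda>_. \<eta>\<^sub>0)" and x: "x \<in> \<Omega>"
    then have \<Omega>: "open \<Omega>" and lip: "L-lipschitz_on UNIV u" and sc: "semiconcave SC u"
      and visc: "viscosity_ge (\<lambda>v x. ereal (1 - s) * frac_hess2 s v x) \<Omega> u (\<lambda>_. \<eta>\<^sub>0)" by auto
    have "continuous_on UNIV u" using sc by (simp add: semiconcave_def)
    then have um [measurable]: "u \<in> borel_measurable borel"
      by (rule borel_measurable_continuous_onI)
    define J where "J = (\<lambda>Q (d :: real^'n). integral\<^sup>L lborel (frac_int s u x (conj_vec Q d)))"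
    define rt where "rt = (\<lambda>m :: real^'n. \<chi> i. sqrt (m $ i))"
    have ptw: "integrable lborel (frac_int s u x (conj_vec Q (rt m)))" "\<eta> \<le> J Q (rt m)"
      if "conj_diag Q m \<in> coeffs2" "orthogonal_matrix Q" "\<And>i. m $ i > 0" for Q m
      using viscosity_ge_pointwise[OF s lip sc \<Omega> x visc that(1) refl that(2,3)]
      by (auto simp: J_def rt_def \<eta>_def)
    have lin: "frac_linear s (conj_diag Q m) u x = ereal (J Q (rt m) / 2)"
      if "conj_diag Q m \<in> coeffs2" "orthogonal_matrix Q" "\<And>i. m $ i > 0" for Q m
      using frac_linear_conj_diag[OF that(2,3) um] ptw(1)[OF that]
      by (simp add: ext_integral_eq_integral J_def rt_def)
    define I where "I = (\<chi> i::'n. \<kappa>)"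
    have I: "conj_diag (mat 1) I \<in> coeffs2" "I $ i > 0" for i using \<kappa> by (auto simp: I_def)
    have JI: "J (mat 1) (rt I) \<le> P"
    proof -
      have bd: "frac_int s u x (conj_vec (mat 1) (rt I)) w \<le> (SC + 2 * L) * frac_bound s w" for w
      proof -
        have "conj_vec (mat 1) (rt I) w = sqrt \<kappa> *\<^sub>R w"
          by (simp add: conj_vec_def rt_def I_def vec_eq_iff)
        then have "norm (conj_vec (mat 1) (rt I) w) \<le> 1 * norm w"
          using \<kappa> by (simp add: mult_left_le_one_le)
        then show ?thesis
          using frac_int_upper[where K = "SC + 2 * L" and a = 1, OF _ second_diff_upper[OF lip sc]] L SC
          by simp
      qed
      have "J (mat 1) (rt I) \<le> integral\<^sup>L lborel (\<lambda>w::real^'n. (SC + 2 * L) * frac_bound s w)"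
        unfolding J_def
        by (rule integral_mono[OF ptw(1)[OF I(1) orthogonal_matrix_id I(2)] _ bd])
           (intro integrable_mult_right integrable_frac_bound s)
      then show ?thesis by (simp add: P_def)
    qed
    have degenerate: "P \<le> J Q (rt m)"
      if M: "conj_diag Q m \<in> coeffs2" and Q: "orthogonal_matrix Q" and m: "\<And>i. m $ i > 0"
        and k: "m $ k < \<theta>" for Q m k
    proof -
      define \<tau> where "\<tau> = (\<Sum>i\<in>UNIV - {k}. m $ i)"
      have cone: "(\<Sum>i\<in>UNIV. m $ i)\<^sup>2 / (real CARD('n) - 1) - (\<Sum>i\<in>UNIV. (m $ i)\<^sup>2) = 1/2"
        using M unfolding conj_diag_coeffs2_iff[OF n Q] by blast
      obtain \<epsilon> where \<epsilon>: "\<tau> \<ge> (N - 1) / (4 * m $ k)" "T / \<tau> * m $ k \<le> \<epsilon>" "\<epsilon> \<le> (N - 1) / T"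
        "conj_diag Q (\<chi> i. if i = k then \<epsilon> else T / \<tau> * m $ i) \<in> coeffs2"
        using raise_small_eigenvalue[OF n m cone, of T k Q] TN k \<theta>(3) Q unfolding N_def \<tau>_def by force
      have \<tau>0: "\<tau> > 0"
        using \<epsilon>(1) N2 m[of k] by (smt (verit) divide_pos_pos)
      define c where "c = T / \<tau>"
      have c: "c > 0" using T0 \<tau>0 by (simp add: c_def)
      define m' where "m' = (\<chi> i. if i = k then \<epsilon> else c * m $ i)"
      have \<epsilon>0: "\<epsilon> > 0" using \<epsilon>(2) mult_pos_pos[OF c m[of k]] by (simp add: c_def)
      have m': "conj_diag Q m' \<in> coeffs2" "m' $ i > 0" for i
      proof -
        show "conj_diag Q m' \<in> coeffs2" using \<epsilon>(4) unfolding m'_def c_def by blast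
        show "m' $ i > 0" using \<epsilon>0 c m by (simp add: m'_def)
      qed
      \<comment> \<open>\<open>rt\<close> takes roots of eigenvalues, so scaling the matrix by
        \<open>c\<close> scales the vector by \<open>sqrt c\<close>, and the exponent 2 s becomes
        s.\<close>
      have rtc: "rt m = inverse (sqrt c) *\<^sub>R rt (c *\<^sub>R m)"
        using c by (simp add: rt_def vec_eq_iff real_sqrt_mult)
      have sc': "integrable lborel (frac_int s u x (conj_vec Q (rt (c *\<^sub>R m))))"
        "J Q (rt m) = inverse (sqrt c) powr (2 * s) * J Q (rt (c *\<^sub>R m))"
        using integral_frac_int_scale[OF s lip sc, of "inverse (sqrt c)" x Q "rt (c *\<^sub>R m)"] ptw(1)[OF M Q m] c
        by (simp_all add: rtc[symmetric] J_def)
      have "J Q (rt m') \<le> J Q (rt (c *\<^sub>R m)) + (SC + 2 * L) * rt m' $ k * integral\<^sup>L lborel (frac_bound s :: real^'n \<Rightarrow> real)"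
        unfolding J_def
      proof (rule integral_frac_int_shrink[OF s lip sc Q _ _ _ _ ptw(1)[OF m'(1) Q m'(2)] sc'(1)])
        show "rt m' $ i = rt (c *\<^sub>R m) $ i" if "i \<noteq> k" for i using that by (simp add: rt_def m'_def)
        show "0 \<le> rt (c *\<^sub>R m) $ k" using c m[of k] by (simp add: rt_def less_imp_le)
        show "rt (c *\<^sub>R m) $ k \<le> rt m' $ k" using \<epsilon>(2) by (simp add: rt_def m'_def c_def)
        have "(N - 1) / T \<le> 1" using TN T0 by (simp add: divide_le_eq)
        then show "rt m' $ k \<le> 1" using \<epsilon>(3) by (simp add: rt_def m'_def)
      qed
      also have "(SC + 2 * L) * rt m' $ k * integral\<^sup>L lborel (frac_bound s :: real^'n \<Rightarrow> real) = P * sqrt \<epsilon>"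
        by (simp add: P_def rt_def m'_def)
      also have "P * sqrt \<epsilon> \<le> P * sqrt ((N - 1) / T)"
        using P \<epsilon>(3) by (intro mult_left_mono) auto
      finally have half: "\<eta> / 2 \<le> J Q (rt (c *\<^sub>R m))"
        using PT ptw(2)[OF m'(1) Q m'(2)] by linarith
      have "P \<le> (\<tau> / T) powr s * (\<eta> / 2)"
      proof -
        have "T * A \<le> \<tau>"
        proof -
          have "T * A \<le> 1 / (4 * \<theta>)" by (rule \<theta>)
          also have "\<dots> \<le> 1 / (4 * m $ k)" using k m[of k] by (intro divide_left_mono) auto
          also have "\<dots> \<le> (N - 1) / (4 * m $ k)" using N2 m[of k] by (intro divide_right_mono) auto
          finally show ?thesis using \<epsilon>(1) by linarith
        qed
        then have "A powr s \<le> (\<tau> / T) powr s"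
          using A T0 s by (intro powr_mono2) (auto simp: field_simps)
        moreover have "A powr s = 2 * P / \<eta>"
          using P \<eta> s by (simp add: A_def powr_powr)
        ultimately show ?thesis using \<eta> by (simp add: field_simps)
      qed
      also have "(\<tau> / T) powr s = inverse (sqrt c) powr (2 * s)"
      proof -
        have "inverse (sqrt c) powr (2 * s) = ((inverse (sqrt c)) powr 2) powr s" by (simp add: powr_powr)
        also have "(inverse (sqrt c)) powr 2 = \<tau> / T"
          using c by (simp add: powr_numeral power_inverse c_def)
        finally show ?thesis by simp
      qed
      also have "inverse (sqrt c) powr (2 * s) * (\<eta> / 2) \<le> J Q (rt m)"
        unfolding sc'(2) using half by (intro mult_left_mono) auto
      finally show ?thesis .
    qed
    show "frac_hess2 s u x = frac_hess2_trunc s \<theta> u x"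
    proof (rule antisym)
      show "frac_hess2 s u x \<le> frac_hess2_trunc s \<theta> u x"
        unfolding frac_hess2_def frac_hess2_trunc_def by (rule INF_superset_mono) auto
      show "frac_hess2_trunc s \<theta> u x \<le> frac_hess2 s u x"
        unfolding frac_hess2_def
      proof (rule INF_greatest)
        fix M :: "real^'n^'n" assume M: "M \<in> coeffs2"
        then obtain Q m where Q: "orthogonal_matrix Q" and Mm: "M = conj_diag Q m" and m: "\<And>i. m $ i > 0"
          using coeffs2_conj_diagE[OF n] by metis
        show "frac_hess2_trunc s \<theta> u x \<le> frac_linear s M u x"
        proof (cases "min_eigenvalue M \<ge> \<theta>")
          case True
          with M show ?thesis unfolding frac_hess2_trunc_def by (intro INF_lower) auto
        next
          case False
          have "Min (range (($) m)) \<in> range (($) m)" by (rule Min_in) auto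
          with False obtain k where k: "m $ k < \<theta>"
            by (auto simp: Mm min_eigenvalue_conj_diag[OF Q] not_le)
          \<comment> \<open>A matrix with an eigenvalue below \<theta> is compared with the
            isotropic one: the latter's integral is at most \<open>P\<close>, the former's at least
            \<open>P\<close>.\<close>
          have "range (($) I) = {\<kappa>}" by (auto simp: I_def)
          then have "min_eigenvalue (conj_diag (mat 1) I) \<ge> \<theta>"
            using \<theta>(2) by (simp add: min_eigenvalue_conj_diag[OF orthogonal_matrix_id])
          then have "frac_hess2_trunc s \<theta> u x \<le> frac_linear s (conj_diag (mat 1) I) u x"
            unfolding frac_hess2_trunc_def using I by (intro INF_lower) auto
          also have "\<dots> = ereal (J (mat 1) (rt I) / 2)" by (rule lin[OF I(1) orthogonal_matrix_id I(2)])
          also have "\<dots> \<le> ereal (J Q (rt m) / 2)"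
            using JI degenerate[OF M[unfolded Mm] Q m k] by simp
          also have "\<dots> = frac_linear s M u x"
            unfolding Mm by (rule lin[OF M[unfolded Mm] Q m, symmetric])
          finally show ?thesis .
        qed
      qed
    qed
  qed
qed

end
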